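(* Let $k>1$ be a natural number. For $x\in[0,1)\setminus\mathbb{Q}$ let $\{p_j/q_j\}_{j\ge 1}$ be the sequence of convergents (in lowest terms) of the continued fraction of $x$. Then, for every $x\in[0,1)\setminus\mathbb{Q}$, the series $$F_k(x)=\sum_{n=1}^{\infty}\frac{e(n^k x)}{n}$$ converges if and only if the series $$\sum_{i=1}^{\infty}\frac{\xi_{p_i/q_i}}{k\,q_i}\ln\frac{q_{i+1}}{q_i}$$ converges. Moreover, the difference between the sum of the latter series and $F_k(x)$ is uniformly bounded in $x$ (over all $x\in[0,1)\setminus\mathbb{Q}$ at which the two series converge).
   Context: Notation: $e(y):=e^{2\pi i y}$. For a reduced fraction $p/q$ with $q\ge 1$, $\xi_{p/q}=\xi_{p/q}^k:=\sum_{t=0}^{q-1}e\big(t^k\frac{p}{q}\big)$. Convergence of a series means convergence of its sequence of partial sums. The convergents of $x=[0;a_1,a_2,\dots]$ are numbered starting from $j=1$: $p_1/q_1=0/1$ and $p_{j+1}/q_{j+1}=[0;a_1,\dots,a_j]$ for $j\ge 1$. *)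

theory Defs
  imports Complex_Main
begin

definition unit_exp :: "real \<Rightarrow> complex" where
  "unit_exp y = exp (2 * of_real pi * \<i> * of_real y)"

text \<open>The complete exponential sum attached to the reduced form of a rational number.\<close>

definition gauss_sum :: "nat \<Rightarrow> rat \<Rightarrow> complex" where
  "gauss_sum k r =
     (let (p, q) = quotient_of r
      in \<Sum>t\<in>{0..<q}. unit_exp (of_int t ^ k * (of_int p / of_int q)))"

text \<open>\<open>cf_eval [a\<^sub>1, \<dots>, a\<^sub>m]\<close> is the finite continued fraction \<open>[0; a\<^sub>1, \<dots>, a\<^sub>m]\<close>;
  the leading zero is implicit.\<close>

fun cf_eval :: "int list \<Rightarrow> rat" where
  "cf_eval [] = 0"
| "cf_eval (a # as) = 1 / (of_int a + cf_eval as)"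

text \<open>Partial quotients \<open>a\<^sub>i\<close>, \<open>i \<ge> 1\<close>, of an irrational number in \<open>[0,1)\<close>, obtained by iterating
  the Gauss map. \<open>cf_quot x 0\<close> is a junk value that is never used.\<close>

primrec cf_rem :: "real \<Rightarrow> nat \<Rightarrow> real" where
  "cf_rem x 0 = x"
| "cf_rem x (Suc n) = frac (1 / cf_rem x n)"

definition cf_quot :: "real \<Rightarrow> nat \<Rightarrow> int" where
  "cf_quot x i = \<lfloor>1 / cf_rem x (i - 1)\<rfloor>"

text \<open>Convergents are numbered from 1: the first one is 0 and the one with index \<open>j + 1\<close> is
  \<open>[0; a\<^sub>1, \<dots>, a\<^sub>j]\<close>.\<close>

definition convergent_cf :: "real \<Rightarrow> nat \<Rightarrow> rat" where
  "convergent_cf x j = cf_eval (map (cf_quot x) [1..<j])"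

definition convergent_den :: "real \<Rightarrow> nat \<Rightarrow> int" where
  "convergent_den x j = snd (quotient_of (convergent_cf x j))"

text \<open>The terms of the two series, both indexed from 1.\<close>

definition F_term :: "nat \<Rightarrow> real \<Rightarrow> nat \<Rightarrow> complex" where
  "F_term k x n = unit_exp (of_nat n ^ k * x) / of_nat n"

definition convergent_term :: "nat \<Rightarrow> real \<Rightarrow> nat \<Rightarrow> complex" where
  "convergent_term k x i =
     gauss_sum k (convergent_cf x i) / (of_nat k * of_int (convergent_den x i))
       * of_real (ln (of_int (convergent_den x (Suc i)) / of_int (convergent_den x i)))"

end

theory Submission
  imports Defs "HOL-Analysis.Harmonic_Numbers"
begin

text \<open>
Let \<open>q\<^sub>j\<close> be the denominators of the convergents \<open>p\<^sub>j / q\<^sub>j\<close> of \<open>x\<close>.  Cut the range of summation of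
\<open>F\<^sub>k(x)\<close> at the squares \<open>q\<^sub>j\<^sup>2\<close>.  The theorem holds because the part of the sum over
\<open>q\<^sub>j\<^sup>2 < n \<le> q\<^sub>j\<^sub>+\<^sub>1\<^sup>2\<close> equals the \<open>j\<close>-th term of the series over convergents up to an error
\<open>O(q\<^sub>j\<^sup>-\<^sup>\<eta>)\<close>, with \<open>\<eta> > 0\<close> and the implied constant depending only on \<open>k\<close>, and because the partial
sums inside a block are bounded by the modulus of that term plus such an error (\<open>full_scale_approx\<close>,
\<open>partial_scale_bound\<close>).  Since the \<open>q\<^sub>j\<close> grow exponentially, the errors are summable uniformly in \<open>x\<close>;
\<open>block_sum_comparison\<close> then gives both the equivalence and the bound.

In one block, with \<open>q = q\<^sub>j\<close> and \<open>Q = q\<^sub>j\<^sub>+\<^sub>1\<close>, one has \<open>|x - p / q|\<close> of order \<open>1 / (q Q)\<close>.  Up to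
\<open>n \<approx> Q\<^sup>1\<^sup>/\<^sup>k\<close> the values \<open>e(n\<^sup>k x)\<close> behave like the periodic function \<open>e(n\<^sup>k p / q)\<close>, whose mean is
\<open>\<xi> / q\<close>, and produce \<open>(\<xi> / q) \<Sum> 1 / n\<close> over \<open>q\<^sup>2 < n \<le> Q\<^sup>1\<^sup>/\<^sup>k\<close>.  This is
\<open>(\<xi> / q) (ln (Q / q) / k + O(1 + ln q))\<close>, and as \<open>\<xi> / q\<close> decays like a power of \<open>q\<close>
(\<open>gauss_sum_bound\<close>), the logarithm in the error is absorbed.  From \<open>Q\<^sup>1\<^sup>/\<^sup>k\<close> on there is cancellation
(\<open>minor_range_bound\<close>).

Both the decay of Gauss sums and the cancellation follow from one statement, an inverse form of
Weyl's inequality (\<open>monomial_weyl_inverse\<close>): if a sum of \<open>e(n\<^sup>k x)\<close> over an interval of length \<open>N\<close> is at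
least \<open>N / X\<close>, then for some \<open>r \<le> A X\<^sup>B\<close> the number \<open>r x\<close> is within \<open>A X\<^sup>B / N\<^sup>k\<close> of an integer.  It is
proved by induction on the degree: Weyl differencing lowers the degree, and
\<open>vinogradov_clustering\<close> recovers the approximation to \<open>x\<close> from those of its multiples \<open>h x\<close>.
\<close>

section \<open>The additive character\<close>

lemma unit_exp_add: "unit_exp (a + b) = unit_exp a * unit_exp b"
  by (simp add: unit_exp_def algebra_simps exp_add)

lemma norm_unit_exp [simp]: "cmod (unit_exp a) = 1"
proof -
  have "unit_exp a = exp (\<i> * of_real (2 * pi * a))"
    by (simp add: unit_exp_def algebra_simps)
  then show ?thesis by (simp only: norm_exp_i_times)
qed

lemma unit_exp_of_int [simp]: "unit_exp (of_int n) = 1"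
  using exp_integer_2pi[of "of_int n"] by (simp add: unit_exp_def ac_simps)

lemma unit_exp_0 [simp]: "unit_exp 0 = 1"
  by (simp add: unit_exp_def)

lemma cnj_unit_exp: "cnj (unit_exp a) = unit_exp (- a)"
  by (simp add: unit_exp_def exp_cnj)

lemma unit_exp_add_int: "unit_exp (a + of_int n) = unit_exp a"
  by (simp add: unit_exp_add)

lemma norm_unit_exp_minus_1: "cmod (unit_exp t - 1) = 2 * \<bar>sin (pi * t)\<bar>"
proof -
  have "unit_exp t = exp (\<i> * of_real (2 * pi * t))"
    by (simp add: unit_exp_def algebra_simps)
  then show ?thesis by (simp only: dist_exp_i_1) (simp add: algebra_simps)
qed

lemma norm_unit_exp_diff_le: "cmod (unit_exp a - unit_exp b) \<le> 2 * pi * \<bar>a - b\<bar>"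
proof -
  have "unit_exp a - unit_exp b = unit_exp b * (unit_exp (a - b) - 1)"
    using unit_exp_add[of b "a - b"] by (simp add: algebra_simps)
  then have "cmod (unit_exp a - unit_exp b) = 2 * \<bar>sin (pi * (a - b))\<bar>"
    by (simp add: norm_mult norm_unit_exp_minus_1)
  also have "\<dots> \<le> 2 * \<bar>pi * (a - b)\<bar>"
    using abs_sin_x_le_abs_x[of "pi * (a - b)"] by linarith
  finally show ?thesis by (simp add: abs_mult)
qed

text \<open>The chord from \<open>1\<close> to \<open>e(t)\<close> has length \<open>2 |sin (\<pi> t)|\<close>; on \<open>|t| \<le> 1/2\<close> the cubic Taylor bound
for the sine already gives \<open>|sin y| \<ge> |y| / 2\<close>, which suffices because constants are immaterial here.\<close>

lemma abs_le_norm_unit_exp_minus_1: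
  assumes "\<bar>t\<bar> \<le> 1/2"
  shows "\<bar>t\<bar> \<le> cmod (unit_exp t - 1)"
proof -
  define y where "y = pi * t"
  have y: "\<bar>y\<bar> \<le> 1.6"
  proof -
    have "pi * \<bar>t\<bar> \<le> 3.2 * (1/2)"
      using assms pi_less_4 pi_approx by (intro mult_mono) auto
    then show ?thesis by (simp add: y_def abs_mult)
  qed
  have "\<bar>sin y - (\<Sum>m<3. sin_coeff m * y ^ m)\<bar> \<le> inverse (fact 3) * \<bar>y\<bar> ^ 3"
    by (rule Maclaurin_sin_bound)
  moreover have "(\<Sum>m<3. sin_coeff m * y ^ m) = y"
    by (simp add: eval_nat_numeral sin_coeff_def)
  ultimately have "\<bar>sin y - y\<bar> \<le> \<bar>y\<bar> ^ 3 / 6"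
    by (simp add: fact_numeral)
  moreover have "\<bar>y\<bar> ^ 3 / 6 \<le> \<bar>y\<bar> / 2"
  proof -
    have "\<bar>y\<bar>^2 \<le> 1.6^2" using y by (intro power_mono) auto
    then have "\<bar>y\<bar> * \<bar>y\<bar>^2 \<le> \<bar>y\<bar> * 3" by (intro mult_left_mono) (auto simp: power2_eq_square)
    then show ?thesis by (simp add: power3_eq_cube power2_eq_square)
  qed
  ultimately have "\<bar>y\<bar> \<le> 2 * \<bar>sin y\<bar>" by linarith
  moreover have "\<bar>t\<bar> \<le> \<bar>y\<bar>" using pi_ge_two
    by (simp add: y_def abs_mult mult_le_cancel_right1)
  ultimately show ?thesis by (simp add: norm_unit_exp_minus_1 y_def)
qed

section \<open>Multiples of a real number close to the integers\<close>

definition near_int :: "real \<Rightarrow> real \<Rightarrow> bool" where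
  "near_int e y \<longleftrightarrow> (\<exists>a::int. \<bar>y - of_int a\<bar> \<le> e)"

lemma near_int_mono: "near_int e y \<Longrightarrow> e \<le> e' \<Longrightarrow> near_int e' y"
  unfolding near_int_def by (meson order_trans)

lemma near_int_one [simp]: "1 \<le> e \<Longrightarrow> near_int e y"
  unfolding near_int_def by (rule exI[of _ "\<lfloor>y\<rfloor>"]) linarith

lemma near_int_diff:
  assumes "near_int e y" "near_int e' z"
  shows "near_int (e + e') (y - z)"
proof -
  obtain a b :: int where "\<bar>y - of_int a\<bar> \<le> e" "\<bar>z - of_int b\<bar> \<le> e'"
    using assms by (auto simp: near_int_def)
  then have "\<bar>(y - z) - of_int (a - b)\<bar> \<le> e + e'" by simp
  then show ?thesis unfolding near_int_def by blast
qed

lemma near_int_norm_unit_exp: "near_int (cmod (unit_exp y - 1)) y"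
proof -
  define t where "t = y - of_int (round y)"
  have "\<bar>t\<bar> \<le> 1/2" unfolding t_def using of_int_round_abs_le[of y] by linarith
  then have "\<bar>t\<bar> \<le> cmod (unit_exp t - 1)" by (rule abs_le_norm_unit_exp_minus_1)
  moreover have "unit_exp y = unit_exp t"
    using unit_exp_add_int[of t "round y"] by (simp add: t_def)
  ultimately show ?thesis unfolding near_int_def t_def by auto
qed

text \<open>The translates of \<open>G\<close> by \<open>0, s, \<dots>, (I - 1) s\<close> are pairwise disjoint subsets of \<open>{1..N + I s}\<close>.  A set
that is dense in \<open>{1..N}\<close> therefore cannot avoid all the differences \<open>m s\<close> with small \<open>m\<close>.\<close>

lemma inj_on_shift_card:
  fixes G :: "nat set"
  assumes G: "G \<subseteq> {1..N}"
    and inj: "\<And>g g' m. g \<in> G \<Longrightarrow> g' \<in> G \<Longrightarrow> 0 < m \<Longrightarrow> m < I \<Longrightarrow> g' \<noteq> g + m * s"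
  shows "I * card G \<le> N + I * s"
proof -
  have fin: "finite G" using G finite_subset by blast
  have "inj_on (\<lambda>(i, g). g + i * s) ({..<I} \<times> G)"
  proof -
    have aux: False if "i < i'" "i' < I" "g \<in> G" "g' \<in> G" "g + i * s = g' + i' * s"
      for i i' g g'
    proof -
      have "g' + (i' - i) * s + i * s = g' + i' * s" using \<open>i < i'\<close>
        by (simp add: add_mult_distrib[symmetric])
      then have "g = g' + (i' - i) * s" using that(5) by linarith
      then show False using inj[OF that(4,3), of "i' - i"] that(1,2) by auto
    qed
    show ?thesis
    proof (rule inj_onI)
      fix u v
      assume uv: "u \<in> {..<I} \<times> G" "v \<in> {..<I} \<times> G"
        "(case u of (i, g) \<Rightarrow> g + i * s) = (case v of (i, g) \<Rightarrow> g + i * s)"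
      obtain i g i' g' where eq: "u = (i, g)" "v = (i', g')" by fastforce
      then have *: "i < I" "i' < I" "g \<in> G" "g' \<in> G" "g + i * s = g' + i' * s" using uv by auto
      then have "\<not> i < i'" "\<not> i' < i" using aux[of i i' g g'] aux[of i' i g' g] by auto
      then show "u = v" using * eq by auto
    qed
  qed
  moreover have "(\<lambda>(i, g). g + i * s) ` ({..<I} \<times> G) \<subseteq> {1..N + I * s}"
  proof (rule image_subsetI)
    fix u assume "u \<in> {..<I} \<times> G"
    then obtain i g where u: "u = (i, g)" "i < I" "g \<in> G" by auto
    then have "1 \<le> g" "g \<le> N" "i * s \<le> I * s" using G by (auto intro: mult_right_mono)
    then have "1 \<le> g + i * s" "g + i * s \<le> N + I * s" by linarith+
    then show "(case u of (i, g) \<Rightarrow> g + i * s) \<in> {1..N + I * s}" by (simp add: u)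
  qed
  ultimately have "card ({..<I} \<times> G) \<le> card {1..N + I * s}"
    by (rule card_inj_on_le) auto
  then show ?thesis using fin by (simp add: card_cartesian_product)
qed

text \<open>If \<open>h \<beta>\<close> is within \<open>\<epsilon>\<close> of an integer for a proportion \<open>\<delta>\<close> of all \<open>h \<le> N\<close>, where \<open>\<epsilon>\<close> is much smaller
than \<open>\<delta>\<close>, then this is caused by a single small \<open>q\<close> for which \<open>q \<beta>\<close> is closer to an integer by a
further factor of order \<open>N\<close>.  Two good \<open>h\<close> must be at a distance \<open>q < I\<close>, where \<open>I\<close> is about
\<open>2 / \<delta>\<close>, so that \<open>q \<beta> = a + \<theta>\<close> with \<open>|\<theta>| \<le> 2 \<epsilon>\<close>.  Let \<open>s\<close> be the first multiplier with
\<open>s |\<theta>| > 2 \<epsilon>\<close>.  Good numbers never differ by \<open>m s q\<close> with \<open>0 < m < I\<close>, because \<open>m s \<theta>\<close> lies strictly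
between \<open>2 \<epsilon>\<close> and \<open>1 - 2 \<epsilon>\<close> in absolute value.  Counting translates once more gives \<open>N \<le> I s q\<close>,
which bounds \<open>|\<theta>|\<close> because \<open>s |\<theta>| \<le> 4 \<epsilon>\<close>.\<close>

lemma vinogradov_clustering:
  fixes G :: "nat set" and \<beta> \<epsilon> \<delta> :: real
  assumes G: "G \<subseteq> {1..N}" and card: "real (card G) \<ge> \<delta> * real N"
    and N: "N \<ge> 1" and \<delta>: "0 < \<delta>" "\<delta> \<le> 1" and \<epsilon>: "0 \<le> \<epsilon>" "\<epsilon> \<le> \<delta> / 16"
    and near: "\<And>h. h \<in> G \<Longrightarrow> near_int \<epsilon> (of_nat h * \<beta>)"
  shows "\<exists>q::nat. 1 \<le> q \<and> real q \<le> 3 / \<delta> \<and> near_int (36 * \<epsilon> / (\<delta>\<^sup>2 * real N)) (of_nat q * \<beta>)"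
proof -
  define I where "I = nat \<lceil>2 / \<delta>\<rceil>"
  have I1: "2 / \<delta> \<le> real I" unfolding I_def by linarith
  have one: "1 \<le> 1 / \<delta>" using \<delta> by simp
  have I2: "real I \<le> 3 / \<delta>"
  proof -
    have "0 \<le> 2 / \<delta>" using \<delta> by simp
    then have "0 \<le> \<lceil>2 / \<delta>\<rceil>" by linarith
    then have "real I = of_int \<lceil>2 / \<delta>\<rceil>" unfolding I_def by simp
    then have "real I \<le> 2 / \<delta> + 1" by linarith
    also have "\<dots> \<le> 2 / \<delta> + 1 / \<delta>" using one by simp
    finally show ?thesis by (simp add: add_divide_distrib[symmetric])
  qed
  have IG: "2 * real N \<le> real (I * card G)"
  proof -
    have "2 * real N = (2 / \<delta>) * (\<delta> * real N)" using \<delta> by simp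
    also have "\<dots> \<le> real I * real (card G)" using I1 card \<delta> by (intro mult_mono) auto
    finally show ?thesis by simp
  qed
  show ?thesis
  proof (cases "N \<le> I")
    case True
    \<comment> \<open>In this range any element of \<open>G\<close> is small enough to serve as \<open>q\<close>.\<close>
    have "G \<noteq> {}" using IG N by auto
    then obtain h where h: "h \<in> G" by blast
    then have h2: "1 \<le> h" "h \<le> N" using G by auto
    have "real N \<le> 3 / \<delta>" using True I2 by linarith
    then have "\<delta> * real N \<le> 3" using \<delta> by (simp add: field_simps)
    then have "\<delta> * (\<delta> * real N) \<le> 1 * 3" using \<delta> by (intro mult_mono) auto
    then have "\<delta>\<^sup>2 * real N \<le> 36" by (simp add: power2_eq_square mult.assoc)
    then have "\<epsilon> * (\<delta>\<^sup>2 * real N) \<le> \<epsilon> * 36" using \<epsilon> by (intro mult_left_mono) auto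
    then have "\<epsilon> \<le> 36 * \<epsilon> / (\<delta>\<^sup>2 * real N)" using \<delta> N by (simp add: field_simps)
    then have "near_int (36 * \<epsilon> / (\<delta>\<^sup>2 * real N)) (of_nat h * \<beta>)"
      using near[OF h] near_int_mono by blast
    moreover have "real h \<le> 3 / \<delta>" using h2 \<open>real N \<le> 3 / \<delta>\<close> by linarith
    ultimately show ?thesis using h2 by blast
  next
    case False
    obtain g q where gq: "g \<in> G" "g + q \<in> G" "0 < q" "q < I"
    proof (rule ccontr)
      assume "\<not> thesis"
      then have "I * card G \<le> N + I * 1"
        using that by (intro inj_on_shift_card[OF G]) (metis mult.right_neutral)
      then have "real (I * card G) \<le> real (N + I)" by (simp only: of_nat_le_iff)
      then show False using IG False by simp
    qed
    have "near_int (\<epsilon> + \<epsilon>) (of_nat (g + q) * \<beta> - of_nat g * \<beta>)"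
      using near[OF gq(1)] near[OF gq(2)] by (rule near_int_diff[rotated])
    then obtain a where a: "\<bar>of_nat q * \<beta> - of_int a\<bar> \<le> 2 * \<epsilon>"
      by (auto simp: near_int_def algebra_simps)
    define \<theta> where "\<theta> = of_nat q * \<beta> - of_int a"
    have q3: "real q \<le> 3 / \<delta>" using gq I2 by linarith
    have goal: "\<bar>\<theta>\<bar> \<le> 36 * \<epsilon> / (\<delta>\<^sup>2 * real N)"
    proof (cases "\<theta> = 0")
      case True then show ?thesis using \<epsilon> by simp
    next
      case \<theta>0: False
      define s where "s = nat \<lfloor>2 * \<epsilon> / \<bar>\<theta>\<bar>\<rfloor> + 1"
      have s: "real s = of_int \<lfloor>2 * \<epsilon> / \<bar>\<theta>\<bar>\<rfloor> + 1" using \<epsilon> unfolding s_def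
        by simp
      then have "2 * \<epsilon> / \<bar>\<theta>\<bar> < real s" "real s \<le> 2 * \<epsilon> / \<bar>\<theta>\<bar> + 1" by linarith+
      then have s1: "2 * \<epsilon> < real s * \<bar>\<theta>\<bar>" and "real s * \<bar>\<theta>\<bar> \<le> 2 * \<epsilon> + \<bar>\<theta>\<bar>"
        using \<theta>0 by (simp_all add: field_simps)
      then have s2: "real s * \<bar>\<theta>\<bar> \<le> 4 * \<epsilon>" using a by (simp add: \<theta>_def)
      have "g2 \<noteq> g1 + m * (s * q)" if g12: "g1 \<in> G" "g2 \<in> G" "0 < m" "m < I" for g1 g2 m
      proof
        assume eq: "g2 = g1 + m * (s * q)"
        have "near_int (\<epsilon> + \<epsilon>) (of_nat g2 * \<beta> - of_nat g1 * \<beta>)"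
          using near[OF g12(1)] near[OF g12(2)] by (rule near_int_diff[rotated])
        also have "of_nat g2 * \<beta> - of_nat g1 * \<beta> = of_nat (m * s) * (of_nat q * \<beta>)"
          by (simp add: eq algebra_simps)
        also have "of_nat q * \<beta> = \<theta> + of_int a" by (simp add: \<theta>_def)
        finally obtain b :: int where b: "\<bar>of_nat (m * s) * (\<theta> + of_int a) - of_int b\<bar> \<le> 2 * \<epsilon>"
          by (auto simp: near_int_def)
        define c where "c = b - int (m * s) * a"
        have c: "\<bar>of_nat (m * s) * \<theta> - of_int c\<bar> \<le> 2 * \<epsilon>"
          using b by (simp add: c_def algebra_simps)
        have big: "2 * \<epsilon> < \<bar>of_nat (m * s) * \<theta>\<bar>"
        proof -
          have "1 * (real s * \<bar>\<theta>\<bar>) \<le> real m * (real s * \<bar>\<theta>\<bar>)"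
            using g12(3) by (intro mult_right_mono) auto
          then show ?thesis using s1 by (simp add: abs_mult mult.assoc)
        qed
        have small: "\<bar>of_nat (m * s) * \<theta>\<bar> \<le> 3/4"
        proof -
          have "real m * (real s * \<bar>\<theta>\<bar>) \<le> (3 / \<delta>) * (4 * \<epsilon>)"
            using g12(4) I2 by (intro mult_mono[OF _ s2]) (use \<delta> in auto)
          also have "\<dots> \<le> (3 / \<delta>) * (4 * (\<delta> / 16))"
            using \<epsilon> \<delta> by (intro mult_left_mono) auto
          also have "\<dots> = 3/4" using \<delta> by simp
          finally show ?thesis by (simp add: abs_mult mult.assoc)
        qed
        have "c \<noteq> 0" using c big by auto
        then have "1 \<le> \<bar>real_of_int c\<bar>" by linarith
        moreover have "2 * \<epsilon> \<le> 1/8" using \<epsilon> \<delta> by linarith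
        ultimately show False using c small by linarith
      qed
      then have "I * card G \<le> N + I * (s * q)" using inj_on_shift_card[OF G] by blast
      then have "real (I * card G) \<le> real N + real I * (real s * real q)"
        by (metis of_nat_add of_nat_le_iff of_nat_mult)
      then have "real N \<le> real I * (real s * real q)" using IG by linarith
      then have "real N * \<bar>\<theta>\<bar> \<le> real I * (real s * real q) * \<bar>\<theta>\<bar>" by (intro mult_right_mono) auto
      also have "\<dots> = real I * real q * (real s * \<bar>\<theta>\<bar>)" by simp
      also have "\<dots> \<le> (3 / \<delta>) * (3 / \<delta>) * (4 * \<epsilon>)"
        using I2 q3 by (intro mult_mono[OF _ s2] mult_mono) (use \<delta> \<epsilon> in auto)
      finally have "real N * \<bar>\<theta>\<bar> \<le> 36 * \<epsilon> / \<delta>\<^sup>2" by (simp add: power2_eq_square)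
      then show ?thesis using N \<delta> by (simp add: field_simps)
    qed
    then have "near_int (36 * \<epsilon> / (\<delta>\<^sup>2 * real N)) (of_nat q * \<beta>)"
      unfolding near_int_def \<theta>_def by blast
    then show ?thesis using gq(3) q3 by (intro exI[of _ q]) auto
  qed
qed

section \<open>Weyl differencing\<close>

text \<open>\<open>iterated_difference d A f\<close> says that applying the differences with steps \<open>h\<^sub>1, \<dots>, h\<^sub>d\<close> to \<open>f\<close> yields
the constant \<open>h\<^sub>1 \<dots> h\<^sub>d A\<close>.  This holds for a polynomial of degree \<open>d\<close> whose leading coefficient is
\<open>A / d!\<close>, and it is exactly the information about a polynomial phase that Weyl differencing hands
down from one degree to the next.\<close>

primrec iterated_difference :: "nat \<Rightarrow> real \<Rightarrow> (int \<Rightarrow> real) \<Rightarrow> bool" where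
  "iterated_difference 0 A f \<longleftrightarrow> (\<forall>n. f n = A)"
| "iterated_difference (Suc d) A f \<longleftrightarrow>
     (\<forall>h. iterated_difference d (of_int h * A) (\<lambda>n. f (n + h) - f n))"

lemma iterated_difference_add:
  "iterated_difference d A f \<Longrightarrow> iterated_difference d B g \<Longrightarrow>
    iterated_difference d (A + B) (\<lambda>n. f n + g n)"
proof (induction d arbitrary: A B f g)
  case (Suc d)
  have "iterated_difference d (of_int h * (A + B)) (\<lambda>n. (f (n + h) + g (n + h)) - (f n + g n))" for h
  proof -
    have "iterated_difference d (of_int h * A + of_int h * B)
        (\<lambda>n. (f (n + h) - f n) + (g (n + h) - g n))"
      using Suc.prems by (intro Suc.IH) auto
    then show ?thesis by (simp add: algebra_simps)
  qed
  then show ?case by simp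
qed simp

lemma iterated_difference_scale:
  "iterated_difference d A f \<Longrightarrow> iterated_difference d (c * A) (\<lambda>n. c * f n)"
proof (induction d arbitrary: A f)
  case (Suc d)
  have "iterated_difference d (of_int h * (c * A)) (\<lambda>n. c * f (n + h) - c * f n)" for h
  proof -
    have "iterated_difference d (c * (of_int h * A)) (\<lambda>n. c * (f (n + h) - f n))"
      using Suc.prems by (intro Suc.IH) auto
    then show ?thesis by (simp add: algebra_simps)
  qed
  then show ?case by simp
qed simp

lemma iterated_difference_Suc_0:
  "iterated_difference d A f \<Longrightarrow> iterated_difference (Suc d) 0 f"
proof (induction d arbitrary: A f)
  case (Suc d)
  have "iterated_difference (Suc d) 0 (\<lambda>n. f (n + h) - f n)" for h
    using Suc.IH[of "of_int h * A" "\<lambda>n. f (n + h) - f n"] Suc.prems by simp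
  then show ?case by (subst iterated_difference.simps) simp
qed simp

lemma iterated_difference_less_0:
  "iterated_difference d A f \<Longrightarrow> d < d' \<Longrightarrow> iterated_difference d' 0 f"
proof (induction d')
  case (Suc d')
  then show ?case
    by (cases "d = d'") (blast intro: iterated_difference_Suc_0, metis Suc.IH less_SucE iterated_difference_Suc_0)
qed simp

lemma iterated_difference_sum_0:
  assumes "\<And>i. i \<in> S \<Longrightarrow> iterated_difference d 0 (f i)"
  shows "iterated_difference d 0 (\<lambda>n. \<Sum>i\<in>S. f i n)"
proof -
  have zero: "iterated_difference d 0 (\<lambda>n. 0)" for d by (induction d) simp_all
  show ?thesis
    using assms
  proof (induction S rule: infinite_finite_induct)
    case (insert i S)
    then show ?case using iterated_difference_add[of d 0 "f i" 0 "\<lambda>n. \<Sum>i\<in>S. f i n"] by simp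
  qed (simp_all add: zero)
qed

lemma iterated_difference_power:
  "iterated_difference d (fact d) (\<lambda>n. of_int n ^ d)"
proof (induction d rule: less_induct)
  case (less d)
  show ?case
  proof (cases d)
    case 0 then show ?thesis by simp
  next
    case (Suc e)
    have "iterated_difference e (of_int h * fact d) (\<lambda>n. of_int (n + h) ^ d - of_int n ^ d)" for h
    proof -
      have binom: "of_int (n + h) ^ d - of_int n ^ d
          = (of_int h * real d) * of_int n ^ e
            + (\<Sum>i<e. (real (d choose i) * of_int h ^ (d - i)) * of_int n ^ i)" for n
      proof -
        have "(of_int (n + h) :: real) ^ d
            = (\<Sum>i\<le>d. real (d choose i) * of_int n ^ i * of_int h ^ (d - i))"
          by (simp add: binomial_ring)
        also have "\<dots> = (\<Sum>i<e. real (d choose i) * of_int n ^ i * of_int h ^ (d - i))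
              + real d * of_int n ^ e * of_int h + of_int n ^ d"
          unfolding Suc by (simp add: lessThan_Suc_atMost[symmetric])
        finally show ?thesis by (simp add: algebra_simps)
      qed
      have "iterated_difference e ((of_int h * real d) * fact e) (\<lambda>n. (of_int h * real d) * of_int n ^ e)"
        using less[of e] Suc by (intro iterated_difference_scale) auto
      moreover have "iterated_difference e 0
          (\<lambda>n. \<Sum>i<e. (real (d choose i) * of_int h ^ (d - i)) * of_int n ^ i)"
      proof (rule iterated_difference_sum_0)
        fix i assume i: "i \<in> {..<e}"
        then have "iterated_difference i (fact i) (\<lambda>n. of_int n ^ i)" using less[of i] Suc by auto
        then have "iterated_difference e 0 (\<lambda>n. of_int n ^ i)"
          using i by (intro iterated_difference_less_0) auto
        then show "iterated_difference e 0 (\<lambda>n. (real (d choose i) * of_int h ^ (d - i)) * of_int n ^ i)"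
          using iterated_difference_scale[of e 0] by simp
      qed
      ultimately have "iterated_difference e ((of_int h * real d) * fact e + 0)
         (\<lambda>n. of_int (n + h) ^ d - of_int n ^ d)"
        unfolding binom by (rule iterated_difference_add)
      then show ?thesis by (simp add: Suc mult.assoc)
    qed
    then show ?thesis by (simp add: Suc)
  qed
qed

text \<open>Expand the square of the sum as a double sum over \<open>(n, m)\<close>.  The diagonal contributes at most \<open>N\<close>, the
parts above and below it are complex conjugates, and below the diagonal one writes \<open>n = m + h\<close>.\<close>

lemma weyl_differencing:
  fixes f :: "int \<Rightarrow> real"
  assumes len: "v - u \<le> int N"
  shows "(cmod (\<Sum>n\<in>{u..<v}. unit_exp (f n)))\<^sup>2
    \<le> real N + 2 * (\<Sum>h\<in>{1..N}. cmod (\<Sum>m\<in>{u..<v - int h}. unit_exp (f (m + int h) - f m)))"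
proof -
  define I where "I = {u..<v}"
  define g where "g = (\<lambda>(n, m). unit_exp (f n - f m))"
  define S where "S = (\<Sum>n\<in>I. unit_exp (f n))"
  define D L U where "D = {p \<in> I \<times> I. fst p = snd p}"
    and "L = {p \<in> I \<times> I. snd p < fst p}" and "U = {p \<in> I \<times> I. fst p < snd p}"
  have fin: "finite I" "finite D" "finite L" "finite U"
    by (auto simp: I_def D_def L_def U_def)
  have "of_real ((cmod S)\<^sup>2) = S * cnj S" by (simp add: complex_norm_square del: of_real_power)
  also have "\<dots> = (\<Sum>n\<in>I. \<Sum>m\<in>I. unit_exp (f n) * unit_exp (- f m))"
    unfolding S_def by (simp add: cnj_sum cnj_unit_exp sum_product)
  also have "\<dots> = (\<Sum>p\<in>I \<times> I. g p)"
    unfolding sum.cartesian_product by (rule sum.cong) (auto simp: g_def unit_exp_add[symmetric])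
  also have "I \<times> I = (D \<union> L) \<union> U" by (auto simp: D_def L_def U_def)
  also have "sum g ((D \<union> L) \<union> U) = sum g D + sum g L + sum g U"
    using fin by (subst sum.union_disjoint, simp_all, force simp: D_def L_def U_def,
      subst sum.union_disjoint) (auto simp: D_def L_def U_def)
  also have "sum g U = cnj (sum g L)"
    unfolding cnj_sum
    by (rule sum.reindex_bij_witness[of _ prod.swap prod.swap])
      (auto simp: U_def L_def g_def cnj_unit_exp)
  finally have "(cmod S)\<^sup>2 = cmod (sum g D + sum g L + cnj (sum g L))"
    by (metis norm_of_real abs_power2)
  also have "\<dots> \<le> cmod (sum g D) + cmod (sum g L) + cmod (cnj (sum g L))"
    by (meson norm_triangle_ineq order_trans add_right_mono)
  also have "\<dots> = cmod (sum g D) + 2 * cmod (sum g L)" by (simp only: complex_mod_cnj)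
  finally have main: "(cmod S)\<^sup>2 \<le> cmod (sum g D) + 2 * cmod (sum g L)" .
  have "cmod (sum g D) \<le> real N"
  proof -
    have "cmod (sum g D) \<le> (\<Sum>p\<in>D. 1)" by (rule sum_norm_le) (auto simp: g_def)
    also have "\<dots> = real (card ((\<lambda>n. (n, n)) ` I))"
      by (simp, rule arg_cong[of _ _ card]) (auto simp: D_def)
    also have "card ((\<lambda>n. (n, n)) ` I) \<le> card I" by (rule card_image_le) (rule fin)
    also have "card I \<le> N" using len by (simp add: I_def)
    finally show ?thesis by simp
  qed
  moreover have "sum g L = (\<Sum>h\<in>{1..N}. \<Sum>m\<in>{u..<v - int h}. unit_exp (f (m + int h) - f m))"
    unfolding sum.Sigma[OF finite_atLeastAtMost ballI[OF finite_atLeastLessThan_int]]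
    by (rule sum.reindex_bij_witness[of _ "\<lambda>(h, m). (m + int h, m)" "\<lambda>(n, m). (nat (n - m), m)"])
      (use len in \<open>auto simp: L_def I_def g_def\<close>)
  then have "cmod (sum g L) \<le> (\<Sum>h\<in>{1..N}. cmod (\<Sum>m\<in>{u..<v - int h}. unit_exp (f (m + int h) - f m)))"
    by (simp add: norm_sum)
  ultimately show ?thesis using main unfolding S_def I_def by linarith
qed

lemma norm_sum_unit_exp_le:
  assumes "v - u \<le> int N"
  shows "cmod (\<Sum>m\<in>{u..<v}. unit_exp (f m)) \<le> real N"
proof -
  have "cmod (\<Sum>m\<in>{u..<v}. unit_exp (f m)) \<le> (\<Sum>m\<in>{u..<v}. 1)" by (rule sum_norm_le) auto
  also have "\<dots> \<le> real N" using assms by simp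
  finally show ?thesis .
qed

lemma norm_linear_exp_sum_le:
  assumes "\<And>n h. f (n + h) - f n = of_int h * \<alpha>"
  shows "cmod (\<Sum>n\<in>{u..<v}. unit_exp (f n)) * cmod (unit_exp \<alpha> - 1) \<le> 2"
proof (cases "u \<le> v")
  case True
  have "(\<Sum>n\<in>{u..<u + int m}. unit_exp (f n)) * (unit_exp \<alpha> - 1) = unit_exp (f (u + int m)) - unit_exp (f u)"
    for m
  proof (induction m)
    case (Suc m)
    have "f (u + int m + 1) = f (u + int m) + \<alpha>" using assms[of "u + int m" 1] by simp
    then have "unit_exp (f (u + int (Suc m))) = unit_exp (f (u + int m)) * unit_exp \<alpha>"
      by (simp add: unit_exp_add[symmetric] algebra_simps)
    moreover have "{u..<u + int (Suc m)} = insert (u + int m) {u..<u + int m}" by auto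
    ultimately show ?case using Suc by (simp add: algebra_simps)
  qed simp
  from this[of "nat (v - u)"] True
  have "(\<Sum>n\<in>{u..<v}. unit_exp (f n)) * (unit_exp \<alpha> - 1) = unit_exp (f v) - unit_exp (f u)"
    by simp
  then have "cmod (\<Sum>n\<in>{u..<v}. unit_exp (f n)) * cmod (unit_exp \<alpha> - 1) = cmod (unit_exp (f v) - unit_exp (f u))"
    by (metis norm_mult)
  also have "\<dots> \<le> 2" using norm_triangle_ineq4[of "unit_exp (f v)" "unit_exp (f u)"] by simp
  finally show ?thesis .
qed simp

text \<open>The values of \<open>q\<close> lie among at most \<open>Y\<close> integers, so one of its fibres contains a proportion \<open>1 / Y\<close>
of \<open>G\<close>.\<close>

lemma pigeonhole_fibre:
  assumes "finite G" "\<And>h. h \<in> G \<Longrightarrow> 1 \<le> q h \<and> real (q h) \<le> Y" "Y > 0"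
  shows "\<exists>r::nat. real (card G) \<le> Y * real (card {h \<in> G. q h = r})"
proof (rule ccontr)
  define Z where "Z = {1..nat \<lfloor>Y\<rfloor>}"
  assume "\<not> ?thesis"
  then have less: "real (card {h \<in> G. q h = r}) < real (card G) / Y" for r
    using assms(3) by (simp add: not_le field_simps)
  then have pos: "0 < real (card G) / Y" by (smt (verit) of_nat_0_le_iff)
  have "q ` G \<subseteq> Z"
    using assms(2) by (force simp: Z_def le_nat_iff le_floor_iff)
  then have "card G = (\<Sum>r\<in>Z. card {h \<in> G. q h = r})"
    using sum.group[of G Z q "\<lambda>_. 1::nat"] assms(1) by (simp add: Z_def)
  then have eq: "real (card G) = (\<Sum>r\<in>Z. real (card {h \<in> G. q h = r}))" by simp
  have "Z \<noteq> {}" using pos eq by force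
  then have "(\<Sum>r\<in>Z. real (card {h \<in> G. q h = r})) < (\<Sum>r\<in>Z. real (card G) / Y)"
    using less by (intro sum_strict_mono) (auto simp: Z_def)
  also have "\<dots> = real (card Z) * (real (card G) / Y)" by simp
  also have "\<dots> \<le> Y * (real (card G) / Y)"
    using pos assms(3) by (intro mult_right_mono) (auto simp: Z_def)
  finally show False using eq assms(3) by simp
qed


section \<open>An inverse theorem for Weyl sums\<close>

text \<open>A Weyl sum of length \<open>N\<close> in degree \<open>d\<close> can only be as large as \<open>N / X\<close> if the leading coefficient,
here multiplied by \<open>d!\<close>, is extremely close to a rational number with a small denominator; all losses are polynomial in \<open>X\<close>.
Stating the bound in this inverse form makes it stable under induction on the degree, without
any estimate for divisor functions.\<close>

definition weyl_inverse :: "nat \<Rightarrow> real \<Rightarrow> nat \<Rightarrow> bool" where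
  "weyl_inverse d A B \<longleftrightarrow> (\<forall>f \<alpha> N X u v. iterated_difference d \<alpha> f \<longrightarrow> 1 \<le> N \<longrightarrow> 1 \<le> X \<longrightarrow>
     v - u \<le> int N \<longrightarrow> real N / X \<le> cmod (\<Sum>n\<in>{u..<v}. unit_exp (f n)) \<longrightarrow>
     (\<exists>q::nat. 1 \<le> q \<and> real q \<le> A * X ^ B \<and> near_int (A * X ^ B / real N ^ d) (of_nat q * \<alpha>)))"

text \<open>A geometric sum with ratio \<open>e(\<alpha>)\<close> has modulus at most \<open>2 / |e(\<alpha>) - 1|\<close>.\<close>

lemma weyl_inverse_linear: "weyl_inverse 1 2 1"
  unfolding weyl_inverse_def
proof (intro allI impI)
  fix f :: "int \<Rightarrow> real" and \<alpha> X :: real and N :: nat and u v :: int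
  assume f: "iterated_difference 1 \<alpha> f" and N: "1 \<le> N" and X: "1 \<le> X"
    and large: "real N / X \<le> cmod (\<Sum>n\<in>{u..<v}. unit_exp (f n))"
  have "real N / X * cmod (unit_exp \<alpha> - 1) \<le> 2"
    using norm_linear_exp_sum_le[of f \<alpha> u v] f mult_right_mono[OF large norm_ge_zero[of "unit_exp \<alpha> - 1"]]
    by simp
  then have "cmod (unit_exp \<alpha> - 1) \<le> 2 * X ^ 1 / real N ^ 1"
    using N X by (simp add: field_simps)
  then have "near_int (2 * X ^ 1 / real N ^ 1) \<alpha>"
    using near_int_norm_unit_exp near_int_mono by blast
  then show "\<exists>q::nat. 1 \<le> q \<and> real q \<le> 2 * X ^ 1 \<and> near_int (2 * X ^ 1 / real N ^ 1) (real q * \<alpha>)"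
    using X by (intro exI[of _ 1]) simp
qed

text \<open>By differencing, a large sum in degree \<open>e + 2\<close> forces many of the shifted sums, those with \<open>h \<in> G\<close>, to
be large.  The phase for the shift \<open>h\<close> has one degree less and iterated difference \<open>h \<alpha>\<close>, so \<open>q\<^sub>h h \<alpha>\<close>
is close to an integer for some small \<open>q\<^sub>h\<close>.  By the pigeonhole principle many \<open>h\<close> share the same
\<open>q\<^sub>h = r\<close>, and clustering applied to \<open>\<beta> = r \<alpha>\<close> gains the missing factor \<open>N\<close>.\<close>

lemma weyl_inverse_Suc:
  assumes IH: "weyl_inverse (Suc e) A B" and A: "A \<ge> 1"
  shows "weyl_inverse (Suc (Suc e)) ((576 * A ^ 3 * 8 ^ (3 * B)) ^ Suc (Suc e)) ((4 + 6 * B) * Suc (Suc e))"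
  unfolding weyl_inverse_def
proof (intro allI impI)
  fix f :: "int \<Rightarrow> real" and \<alpha> X :: real and N :: nat and u v :: int
  assume f: "iterated_difference (Suc (Suc e)) \<alpha> f" and N: "1 \<le> N" and X: "1 \<le> X"
    and len: "v - u \<le> int N"
    and large: "real N / X \<le> cmod (\<Sum>n\<in>{u..<v}. unit_exp (f n))"
  \<comment> \<open>\<open>Y\<close> is the bound in the lower degree for sums of size \<open>N / (8 X\<^sup>2)\<close>; \<open>Z\<close> dominates every bound that occurs below.\<close>
  define Y where "Y = A * (8 * X\<^sup>2) ^ B"
  define D where "D = Suc (Suc e)"
  define Z where "Z = (576 * X ^ 4 * Y ^ 3) ^ D"
  have Z: "(576 * A ^ 3 * 8 ^ (3 * B)) ^ D * X ^ ((4 + 6 * B) * D) = Z"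
    by (simp add: Z_def Y_def power_mult_distrib power_mult[symmetric] power_add algebra_simps)
  have X2: "1 \<le> X\<^sup>2" using X by simp
  have Y1: "1 \<le> Y"
    unfolding Y_def using mult_mono[OF A one_le_power[of "8 * X\<^sup>2" B]] X2 A by simp
  define W where "W = X\<^sup>2 * Y\<^sup>2"
  have W1: "1 \<le> W" unfolding W_def using mult_mono[OF X2 one_le_power[OF Y1, of 2]] by simp
  have XYW: "X\<^sup>2 * Y \<le> W" "X\<^sup>2 \<le> W"
  proof -
    have "Y \<le> Y\<^sup>2" using self_le_power[OF Y1, of 2] by simp
    then show "X\<^sup>2 * Y \<le> W" unfolding W_def using X2 by (intro mult_left_mono) auto
    show "X\<^sup>2 \<le> W" unfolding W_def using X2 one_le_power[OF Y1, of 2] by (simp add: mult_le_cancel_left1)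
  qed
  have WXY: "W \<le> X ^ 4 * Y ^ 3"
  proof -
    have "X ^ 4 * Y ^ 3 = W * (X\<^sup>2 * Y)" by (simp add: W_def eval_nat_numeral)
    moreover have "W * 1 \<le> W * (X\<^sup>2 * Y)"
      using W1 mult_mono[OF X2 Y1] by (intro mult_left_mono) auto
    ultimately show ?thesis by simp
  qed
  have base: "1 \<le> 576 * X ^ 4 * Y ^ 3" using W1 WXY by simp
  have ZW: "576 * X ^ 4 * Y ^ 3 \<le> Z"
    unfolding Z_def using self_le_power[OF base, of D] by (simp add: D_def)
  have "\<exists>q::nat. 1 \<le> q \<and> real q \<le> Z \<and> near_int (Z / real N ^ D) (real q * \<alpha>)"
  \<comment> \<open>For \<open>N\<close> polynomially bounded in \<open>X\<close> the bound on the distance exceeds \<open>1\<close> and \<open>q = 1\<close> will do.\<close>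
  proof (cases "real N \<le> 64 * W")
    case True
    then have "real N ^ D \<le> Z"
      unfolding Z_def using WXY W1 by (intro power_mono) auto
    then have "1 \<le> Z / real N ^ D" using N by simp
    then show ?thesis using base ZW by (intro exI[of _ 1]) simp
  next
    case False
    define T where "T h = cmod (\<Sum>m\<in>{u..<v - int h}. unit_exp (f (m + int h) - f m))" for h
    define G where "G = {h \<in> {1..N}. real N / (8 * X\<^sup>2) \<le> T h}"
    have "finite G" by (simp add: G_def)
    have T_le: "T h \<le> real N" for h
      unfolding T_def using len by (intro norm_sum_unit_exp_le) auto
    have "(real N / X)\<^sup>2 \<le> (cmod (\<Sum>n\<in>{u..<v}. unit_exp (f n)))\<^sup>2"
      using large N X by (intro power_mono) auto
    also have "\<dots> \<le> real N + 2 * (\<Sum>h\<in>{1..N}. T h)"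
      unfolding T_def by (rule weyl_differencing[OF len])
    also have "(\<Sum>h\<in>{1..N}. T h) \<le> (\<Sum>h\<in>{1..N}. (if h \<in> G then real N else 0) + real N / (8 * X\<^sup>2))"
      using T_le X by (intro sum_mono) (auto simp: G_def add_increasing2)
    also have "\<dots> = real (card G) * real N + real N * (real N / (8 * X\<^sup>2))"
    proof -
      have "{1..N} \<inter> G = G" by (auto simp: G_def)
      then show ?thesis by (simp add: sum.distrib sum.If_cases Int_def[symmetric])
    qed
    finally have "real N * (real N / X\<^sup>2) \<le> real N * (1 + 2 * real (card G) + real N / (4 * X\<^sup>2))"
      by (simp add: power2_eq_square algebra_simps)
    then have "real N / X\<^sup>2 \<le> 1 + 2 * real (card G) + real N / (4 * X\<^sup>2)"
      by (rule mult_left_le_imp_le) (use N in simp)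
    moreover have "1 \<le> real N / (4 * X\<^sup>2)" using False XYW(2) X by (simp add: field_simps)
    ultimately have cardG: "real N / (4 * X\<^sup>2) \<le> real (card G)" by (simp add: field_simps)
    have "\<exists>q::nat. 1 \<le> q \<and> real q \<le> Y \<and> near_int (Y / real N ^ Suc e) (real q * (of_int (int h) * \<alpha>))"
      if "h \<in> G" for h
    proof -
      have "iterated_difference (Suc e) (of_int (int h) * \<alpha>) (\<lambda>m. f (m + int h) - f m)"
        using f unfolding iterated_difference.simps(2)[of "Suc e"] by blast
      moreover have "real N / (8 * X\<^sup>2) \<le> cmod (\<Sum>m\<in>{u..<v - int h}. unit_exp (f (m + int h) - f m))"
        using that by (simp add: G_def T_def)
      moreover have "1 \<le> 8 * X\<^sup>2" using X2 by simp
      moreover have "(v - int h) - u \<le> int N" using len by simp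
      ultimately show ?thesis
        using IH[unfolded weyl_inverse_def, rule_format, of "of_int (int h) * \<alpha>" _ N "8 * X\<^sup>2" "v - int h" u] N
        unfolding Y_def by blast
    qed
    then obtain q where q: "\<And>h. h \<in> G \<Longrightarrow> 1 \<le> q h \<and> real (q h) \<le> Y"
      and near: "\<And>h. h \<in> G \<Longrightarrow> near_int (Y / real N ^ Suc e) (real (q h) * (of_int (int h) * \<alpha>))"
      by metis
    obtain r where r: "real (card G) \<le> Y * real (card {h \<in> G. q h = r})"
      using pigeonhole_fibre[of G q Y] q \<open>finite G\<close> Y1 by (meson less_le_trans zero_less_one)
    define H where "H = {h \<in> G. q h = r}"
    define \<delta> where "\<delta> = 1 / (4 * X\<^sup>2 * Y)"
    define \<epsilon> where "\<epsilon> = Y / real N ^ Suc e"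
    have "0 < real N / (4 * X\<^sup>2)" using N X by simp
    then have "0 < Y * real (card H)" using cardG r by (simp add: H_def)
    then have "H \<noteq> {}" by auto
    then have r1: "1 \<le> r" "real r \<le> Y" using q by (auto simp: H_def)
    have "1 \<le> X\<^sup>2 * Y" using mult_mono[OF X2 Y1] by simp
    then have "1 \<le> 4 * X\<^sup>2 * Y" by linarith
    then have \<delta>: "0 < \<delta>" "\<delta> \<le> 1" unfolding \<delta>_def by (auto simp only: zero_less_divide_1_iff divide_le_eq_1)
    have "real N / (4 * X\<^sup>2) \<le> Y * real (card H)" using cardG r by (simp add: H_def)
    then have cardH: "\<delta> * real N \<le> real (card H)" using X Y1 by (simp add: \<delta>_def field_simps)
    have "\<epsilon> \<le> \<delta> / 16"
    proof -
      have "real N ^ 1 \<le> real N ^ Suc e" using N by (intro power_increasing) auto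
      then have "64 * W \<le> real N ^ Suc e" using False by simp
      then have "\<epsilon> \<le> Y / (64 * W)"
        unfolding \<epsilon>_def using Y1 W1 by (intro divide_left_mono) auto
      also have "\<dots> = \<delta> / 16" using Y1 X by (simp add: W_def \<delta>_def power2_eq_square)
      finally show ?thesis .
    qed
    moreover have "H \<subseteq> {1..N}" by (auto simp: H_def G_def)
    moreover have "near_int \<epsilon> (real h * (real r * \<alpha>))" if "h \<in> H" for h
      using near[of h] that by (simp add: H_def \<epsilon>_def algebra_simps)
    moreover have "0 \<le> \<epsilon>" using Y1 by (simp add: \<epsilon>_def)
    ultimately obtain s where s: "1 \<le> s" "real s \<le> 3 / \<delta>"
      "near_int (36 * \<epsilon> / (\<delta>\<^sup>2 * real N)) (real s * (real r * \<alpha>))"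
      using vinogradov_clustering[of H N \<delta> \<epsilon> "real r * \<alpha>"] cardH N \<delta> by blast
    have "real (s * r) \<le> Z"
    proof -
      have "real (s * r) \<le> (12 * X\<^sup>2 * Y) * Y"
        unfolding of_nat_mult using s(2) r1 X2 Y1 by (intro mult_mono) (auto simp: \<delta>_def)
      also have "\<dots> = 12 * W" by (simp add: W_def power2_eq_square)
      finally show ?thesis using WXY ZW W1 by linarith
    qed
    moreover have "36 * \<epsilon> / (\<delta>\<^sup>2 * real N) \<le> Z / real N ^ D"
    proof -
      have "36 * \<epsilon> / (\<delta>\<^sup>2 * real N) = 576 * X ^ 4 * Y ^ 3 / real N ^ D"
        using Y1 X N by (simp add: \<epsilon>_def \<delta>_def D_def field_simps eval_nat_numeral)
      also have "\<dots> \<le> Z / real N ^ D" using ZW N by (intro divide_right_mono) auto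
      finally show ?thesis .
    qed
    then have "near_int (Z / real N ^ D) (real (s * r) * \<alpha>)"
      using near_int_mono[OF s(3)] by (simp add: mult.assoc)
    moreover have "1 \<le> s * r" using s(1) r1(1) by simp
    ultimately show ?thesis by blast
  qed
  then show "\<exists>q::nat. 1 \<le> q \<and>
      real q \<le> (576 * A ^ 3 * 8 ^ (3 * B)) ^ Suc (Suc e) * X ^ ((4 + 6 * B) * Suc (Suc e)) \<and>
      near_int ((576 * A ^ 3 * 8 ^ (3 * B)) ^ Suc (Suc e) * X ^ ((4 + 6 * B) * Suc (Suc e)) / real N ^ Suc (Suc e))
        (real q * \<alpha>)"
    unfolding D_def[symmetric] Z .
qed

lemma weyl_inverse_exists: "\<exists>A B. A \<ge> 1 \<and> B \<ge> 1 \<and> weyl_inverse (Suc e) A B"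
proof (induction e)
  case 0
  have "weyl_inverse (Suc 0) 2 1" using weyl_inverse_linear by simp
  then show ?case by (intro exI[of _ 2] exI[of _ 1]) simp
next
  case (Suc e)
  then obtain A B where AB: "A \<ge> 1" "weyl_inverse (Suc e) A B" by blast
  have "1 \<le> A ^ 3" "(1::real) \<le> 8 ^ (3 * B)" using AB by (auto intro: one_le_power)
  then have "1 \<le> A ^ 3 * 8 ^ (3 * B)" using mult_mono[of 1 "A ^ 3" 1 "8 ^ (3 * B)"] AB by simp
  then have "1 \<le> (576 * A ^ 3 * 8 ^ (3 * B)) ^ Suc (Suc e)" by (intro one_le_power) simp
  moreover have "1 \<le> (4 + 6 * B) * Suc (Suc e)" by simp
  ultimately show ?case using weyl_inverse_Suc[OF AB(2,1)] by blast
qed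

corollary monomial_weyl_inverse:
  assumes "k \<ge> 1"
  obtains A :: real and B :: nat where "A \<ge> 1" "B \<ge> 1"
    "\<And>x N X M M'. 1 \<le> N \<Longrightarrow> 1 \<le> X \<Longrightarrow> M' - M \<le> N \<Longrightarrow>
      real N / X \<le> cmod (\<Sum>n\<in>{M..<M'}. unit_exp (of_nat n ^ k * x)) \<Longrightarrow>
      \<exists>q::nat. 1 \<le> q \<and> real q \<le> A * X ^ B \<and> near_int (A * X ^ B / real N ^ k) (of_nat q * x)"
proof -
  obtain e where k: "k = Suc e" using assms by (cases k) auto
  obtain A B where AB: "A \<ge> 1" "B \<ge> 1" "weyl_inverse k A B" using weyl_inverse_exists k by blast
  show thesis
  proof (rule that[of "fact k * A" B])
    have "1 * 1 \<le> fact k * A" using AB by (intro mult_mono) auto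
    then show "fact k * A \<ge> 1" by simp
    show "B \<ge> 1" by fact
  next
    fix x :: real and N M M' :: nat and X :: real
    assume N: "1 \<le> N" and X: "1 \<le> X" and len: "M' - M \<le> N"
      and large: "real N / X \<le> cmod (\<Sum>n\<in>{M..<M'}. unit_exp (of_nat n ^ k * x))"
    have "iterated_difference k (x * fact k) (\<lambda>n. x * of_int n ^ k)"
      by (intro iterated_difference_scale iterated_difference_power)
    moreover have "(\<Sum>n\<in>{M..<M'}. unit_exp (of_nat n ^ k * x))
        = (\<Sum>n\<in>{int M..<int M'}. unit_exp (x * of_int n ^ k))"
      by (rule sum.reindex_bij_witness[of _ nat int]) (auto simp: mult.commute)
    moreover have "int M' - int M \<le> int N" using len by linarith
    ultimately obtain q where q: "1 \<le> q" "real q \<le> A * X ^ B"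
        "near_int (A * X ^ B / real N ^ k) (real q * (x * fact k))"
      using AB(3)[unfolded weyl_inverse_def, rule_format, of "x * fact k" _ N X "int M'" "int M"]
        N X large by fastforce
    have f1: "(1::real) \<le> fact k" by simp
    have AX: "0 \<le> A * X ^ B" using AB X by simp
    have "real (fact k * q) \<le> fact k * A * X ^ B"
      using mult_left_mono[OF q(2), of "fact k"] by (simp add: mult.assoc)
    moreover have "near_int (fact k * A * X ^ B / real N ^ k) (real (fact k * q) * x)"
    proof -
      have "A * X ^ B / real N ^ k \<le> fact k * (A * X ^ B) / real N ^ k"
        using mult_right_mono[OF f1 AX] by (intro divide_right_mono) auto
      then show ?thesis using near_int_mono[OF q(3)] by (simp add: algebra_simps)
    qed
    moreover have "1 \<le> fact k * q" using q(1) by simp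
    ultimately show "\<exists>q::nat. 1 \<le> q \<and> real q \<le> fact k * A * X ^ B
        \<and> near_int (fact k * A * X ^ B / real N ^ k) (real q * x)" by blast
  qed
qed

section \<open>Partial summation\<close>

lemma summation_by_parts:
  fixes z w :: "nat \<Rightarrow> complex"
  assumes "M \<le> N"
  shows "(\<Sum>n\<in>{M<..N}. z n * w n) = (\<Sum>n\<in>{M<..N}. z n) * w (Suc N)
    + (\<Sum>n\<in>{M<..N}. (\<Sum>m\<in>{M<..n}. z m) * (w n - w (Suc n)))"
  using assms
proof (induction N rule: dec_induct)
  case (step N)
  have "{M<..Suc N} = insert (Suc N) {M<..N}" using step by auto
  then show ?case using step by (simp add: algebra_simps)
qed simp

text \<open>Abel's inequality: a weight of bounded variation multiplies a uniform bound for partial sums at most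
by its final size plus its variation.\<close>

lemma norm_sum_times_variation_le:
  fixes z w :: "nat \<Rightarrow> complex"
  assumes MN: "M \<le> N" and K: "\<And>m. M \<le> m \<Longrightarrow> m \<le> N \<Longrightarrow> cmod (\<Sum>n\<in>{M<..m}. z n) \<le> K"
  shows "cmod (\<Sum>n\<in>{M<..N}. z n * w n) \<le> K * (cmod (w (Suc N)) + (\<Sum>n\<in>{M<..N}. cmod (w n - w (Suc n))))"
proof -
  have "cmod (\<Sum>n\<in>{M<..N}. z n * w n) \<le> cmod ((\<Sum>n\<in>{M<..N}. z n) * w (Suc N))
      + cmod (\<Sum>n\<in>{M<..N}. (\<Sum>m\<in>{M<..n}. z m) * (w n - w (Suc n)))"
    unfolding summation_by_parts[OF MN, of z w] by (rule norm_triangle_ineq)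
  also have "\<dots> \<le> K * cmod (w (Suc N)) + (\<Sum>n\<in>{M<..N}. K * cmod (w n - w (Suc n)))"
    using K MN by (intro add_mono sum_norm_le) (auto simp: norm_mult intro!: mult_right_mono)
  finally show ?thesis by (simp add: distrib_left sum_distrib_left)
qed

text \<open>For the decreasing weight \<open>1 / n\<close> final size and variation telescope to \<open>1 / (M + 1)\<close>.\<close>

lemma norm_sum_over_n_le:
  fixes z :: "nat \<Rightarrow> complex"
  assumes MN: "M \<le> N" and M: "1 \<le> M"
    and K: "\<And>m. M \<le> m \<Longrightarrow> m \<le> N \<Longrightarrow> cmod (\<Sum>n\<in>{M<..m}. z n) \<le> K"
  shows "cmod (\<Sum>n\<in>{M<..N}. z n / of_nat n) \<le> K / real M"
proof -
  define w :: "nat \<Rightarrow> complex" where "w n = of_real (1 / real n)" for n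
  have K0: "0 \<le> K" using K[of M] MN by simp
  have "(\<Sum>n\<in>{M<..N}. cmod (w n - w (Suc n))) = (\<Sum>n\<in>{M<..N}. 1 / real n - 1 / real (Suc n))"
  proof (rule sum.cong)
    fix n assume "n \<in> {M<..N}"
    then have n: "0 < n" by auto
    have "cmod (w n - w (Suc n)) = \<bar>1 / real n - 1 / real (Suc n)\<bar>"
      unfolding w_def of_real_diff[symmetric] norm_of_real ..
    also have "\<dots> = 1 / real n - 1 / real (Suc n)"
      using n by (intro abs_of_nonneg) (simp add: field_simps)
    finally show "cmod (w n - w (Suc n)) = 1 / real n - 1 / real (Suc n)" .
  qed simp
  also have "\<dots> = 1 / real (Suc M) - 1 / real (Suc N)"
    using MN
  proof (induction N rule: dec_induct)
    case (step N)
    have "{M<..Suc N} = insert (Suc N) {M<..N}" using step by auto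
    then show ?case using step by simp
  qed simp
  finally have var: "(\<Sum>n\<in>{M<..N}. cmod (w n - w (Suc n))) = 1 / real (Suc M) - 1 / real (Suc N)" .
  have "cmod (w (Suc N)) = 1 / real (Suc N)"
    unfolding w_def norm_of_real by simp
  then have "cmod (\<Sum>n\<in>{M<..N}. z n * w n) \<le> K * (1 / real (Suc M))"
    using norm_sum_times_variation_le[OF MN K, of w] var by simp
  also have "\<dots> \<le> K * (1 / real M)" using M K0 by (intro mult_left_mono) (auto simp: field_simps)
  finally show ?thesis by (simp add: w_def divide_inverse)
qed

text \<open>The defect \<open>ln (b / a) - \<Sum> 1 / n\<close> grows with \<open>b\<close>, each step by at most \<open>1 / b - 1 / (b + 1)\<close>.\<close>

lemma sum_inverse_approx_ln:
  assumes "1 \<le> a" "a \<le> b"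
  shows "\<bar>(\<Sum>n\<in>{a<..b}. 1 / real n) - ln (real b / real a)\<bar> \<le> 1"
proof -
  have "0 \<le> ln (real b / real a) - (\<Sum>n\<in>{a<..b}. 1 / real n) \<and>
      ln (real b / real a) - (\<Sum>n\<in>{a<..b}. 1 / real n) \<le> 1 / real a - 1 / real b"
    using assms(2)
  proof (induction b rule: dec_induct)
    case (step b)
    have b: "0 < real b" using step assms by simp
    have set: "{a<..Suc b} = insert (Suc b) {a<..b}" using step by auto
    have "ln (real (Suc b) / real a) = ln (real b / real a) + ln (real (Suc b) / real b)"
      using b assms by (simp add: ln_div)
    moreover have "ln (real (Suc b) / real b) \<le> real (Suc b) / real b - 1"
      using b by (intro ln_le_minus_one) simp
    moreover have "real (Suc b) / real b - 1 = 1 / real b" using b by (simp add: field_simps)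
    moreover have "ln (real b / real (Suc b)) \<le> real b / real (Suc b) - 1"
      using b by (intro ln_le_minus_one) simp
    moreover have "real b / real (Suc b) - 1 = - (1 / real (Suc b))" by (simp add: field_simps)
    moreover have "ln (real b / real (Suc b)) = - ln (real (Suc b) / real b)"
      using b by (simp add: ln_div)
    ultimately show ?case using step set by simp
  qed (use assms in simp)
  moreover have "1 / real a \<le> 1" "0 \<le> 1 / real b" using assms by auto
  ultimately show ?thesis by linarith
qed

section \<open>Complete sums over a period\<close>

lemma sum_over_period:
  fixes g :: "nat \<Rightarrow> complex"
  assumes "\<And>n. g (n + q) = g n"
  shows "(\<Sum>n\<in>{a<..a + q}. g n) = (\<Sum>n<q. g n)"
proof (induction a)
  case 0
  have "(\<Sum>n\<in>{0<..q}. g n) + g 0 = (\<Sum>n\<in>{..q}. g n)"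
    by (subst atMost_atLeast0, subst sum.head) auto
  also have "\<dots> = (\<Sum>n<q. g n) + g q" by (simp add: lessThan_Suc_atMost[symmetric])
  finally show ?case using assms[of 0] by simp
next
  case (Suc a)
  have "(\<Sum>n\<in>{Suc a<..Suc a + q}. g n) + g (Suc a) = (\<Sum>n\<in>{a<..Suc a + q}. g n)"
  proof -
    have "{a<..Suc a + q} = insert (Suc a) {Suc a<..Suc a + q}" by auto
    then show ?thesis by simp
  qed
  also have "\<dots> = (\<Sum>n\<in>{a<..a + q}. g n) + g (Suc a + q)"
  proof -
    have "{a<..Suc a + q} = insert (Suc a + q) {a<..a + q}" by auto
    then show ?thesis by simp
  qed
  finally show ?case using assms[of "Suc a"] Suc by simp
qed

text \<open>Full periods cancel, and fewer than \<open>q\<close> terms remain.\<close>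

lemma norm_periodic_sum_le:
  fixes g :: "nat \<Rightarrow> complex"
  assumes per: "\<And>n. g (n + q) = g n" and zero: "(\<Sum>n<q. g n) = 0" and q: "q \<ge> 1"
    and bd: "\<And>n. cmod (g n) \<le> D"
  shows "cmod (\<Sum>n\<in>{M<..N}. g n) \<le> D * real q"
proof (induction "N - M" arbitrary: M rule: less_induct)
  case less
  have D: "0 \<le> D" using bd[of 0] norm_ge_zero order_trans by blast
  show ?case
  proof (cases "N - M < q")
    case True
    have "cmod (\<Sum>n\<in>{M<..N}. g n) \<le> (\<Sum>n\<in>{M<..N}. D)" using bd by (intro sum_norm_le) auto
    also have "\<dots> \<le> D * real q" using True D by (simp add: mult.commute mult_left_mono)
    finally show ?thesis .
  next
    case False
    then have "{M<..N} = {M<..M + q} \<union> {M + q<..N}" using q by auto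
    then have "(\<Sum>n\<in>{M<..N}. g n) = (\<Sum>n\<in>{M<..M + q}. g n) + (\<Sum>n\<in>{M + q<..N}. g n)"
      by (simp add: sum.union_disjoint)
    also have "(\<Sum>n\<in>{M<..M + q}. g n) = 0"
      using sum_over_period[where g = g, OF per] zero by simp
    finally show ?thesis using less[of "M + q"] False q by simp
  qed
qed

lemma unit_exp_power_periodic:
  assumes "q \<ge> 1"
  shows "unit_exp (of_nat (n + q) ^ k * (of_int p / of_nat q)) = unit_exp (of_nat n ^ k * (of_int p / of_nat q))"
proof -
  have "int q dvd int (n + q) ^ k - int n ^ k"
    using power_diff_sumr2[of "int (n + q)" k "int n"] by simp
  then obtain m where "int (n + q) ^ k - int n ^ k = int q * m" by (elim dvdE)
  then have "int (n + q) ^ k = int n ^ k + int q * m" by simp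
  then have m: "real (n + q) ^ k = real n ^ k + real q * of_int m"
    by (metis (mono_tags, lifting) of_int_add of_int_mult of_int_of_nat_eq of_int_power)
  have "real (n + q) ^ k * (of_int p / of_nat q) = real n ^ k * (of_int p / of_nat q) + of_int (m * p)"
    unfolding m using assms by (simp add: field_simps)
  then show ?thesis by (simp only: unit_exp_add_int)
qed

lemma gauss_sum_nat:
  assumes "quotient_of r = (p, int q)"
  shows "gauss_sum k r = (\<Sum>t<q. unit_exp (of_nat t ^ k * (of_int p / of_nat q)))"
  unfolding gauss_sum_def assms
  by simp (rule sum.reindex_bij_witness[of _ int nat], auto)

section \<open>Gauss sums\<close>

text \<open>Turns the conclusion \<open>Z \<le> A X\<^sup>B\<close> of the inverse theorem, in which \<open>N / X\<close> is the size of the sum, into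
a saving of a power of \<open>Z\<close> over the trivial bound \<open>N\<close>.\<close>

lemma inverse_root_bound:
  assumes "0 < Z" "0 < X" "1 \<le> A" "B \<ge> 1" "Z \<le> A * X ^ B"
  shows "1 / X \<le> A * Z powr (- 1 / real B)"
proof -
  have "(1 / X) ^ B \<le> A / Z" using assms by (simp add: field_simps)
  then have "((1 / X) ^ B) powr (1 / real B) \<le> (A / Z) powr (1 / real B)"
    using assms by (intro powr_mono2) auto
  also have "\<dots> = A powr (1 / real B) * Z powr (- 1 / real B)"
    using assms by (simp add: powr_divide powr_minus_divide)
  also have "\<dots> \<le> A * Z powr (- 1 / real B)"
    using assms powr_mono[of "1 / real B" 1 A] by (intro mult_right_mono) auto
  also have "((1 / X) ^ B) powr (1 / real B) = 1 / X"
  proof -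
    have "(1 / X) ^ B = (1 / X) powr real B" using assms by (simp add: powr_realpow)
    then show ?thesis using assms by (simp add: powr_powr)
  qed
  finally show ?thesis .
qed

text \<open>The constants of the inverse theorem for the phase \<open>n\<^sup>k x\<close> are fixed once and for all; every later
constant depends on \<open>k\<close>, \<open>A\<close> and \<open>B\<close> only, which is where the uniformity in \<open>x\<close> comes from.\<close>

locale monomial_weyl =
  fixes k :: nat and A :: real and B :: nat
  assumes k: "k \<ge> 2" and A: "A \<ge> 1" and B: "B \<ge> 1"
    and inverse: "\<And>x N X M M'. 1 \<le> N \<Longrightarrow> 1 \<le> X \<Longrightarrow> M' - M \<le> N \<Longrightarrow>
      real N / X \<le> cmod (\<Sum>n\<in>{M..<M'}. unit_exp (of_nat n ^ k * x)) \<Longrightarrow>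
      \<exists>q::nat. 1 \<le> q \<and> real q \<le> A * X ^ B \<and> near_int (A * X ^ B / real N ^ k) (of_nat q * x)"
begin

text \<open>A quarter of the Weyl exponent \<open>1 / B\<close>: Gauss sums save \<open>q\<close> to the power \<open>4 \<eta>\<close> and incomplete sums
to the power \<open>2 \<eta>\<close>, and the surplus absorbs logarithms of \<open>q\<close>.\<close>

definition \<eta> :: real where "\<eta> = 1 / (4 * real B)"

lemma \<eta>: "0 < \<eta>" "\<eta> \<le> 1/4" "1 / real B = 4 * \<eta>" "1 / real (2 * B) = 2 * \<eta>"
  using B by (auto simp: \<eta>_def field_simps)

text \<open>The inverse theorem for \<open>N = q\<close> and \<open>x = p / q\<close> provides some \<open>n\<close> with \<open>n p / q\<close> near an integer.  Either
\<open>q\<close> divides \<open>n\<close>, or the distance to the nearest integer is at least \<open>1 / q\<close>, which exceeds \<open>q\<^sup>-\<^sup>k\<close> by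
the factor \<open>q\<^sup>k\<^sup>-\<^sup>1 \<ge> q\<close>.  Both force \<open>q \<le> A X\<^sup>B\<close>.\<close>

lemma gauss_sum_bound:
  assumes r: "quotient_of r = (p, int q)"
  shows "cmod (gauss_sum k r) \<le> real q * (A * real q powr (- 4 * \<eta>))"
proof (cases "gauss_sum k r = 0")
  case False
  have q: "q \<ge> 1" and cop: "coprime p (int q)"
    using quotient_of_denom_pos[OF r] quotient_of_coprime[OF r] by auto
  define S where "S = cmod (gauss_sum k r)"
  have S: "0 < S" using False by (simp add: S_def)
  have sum: "gauss_sum k r = (\<Sum>t\<in>{0..<q}. unit_exp (of_nat t ^ k * (of_int p / of_nat q)))"
    unfolding gauss_sum_nat[OF r] by (simp add: atLeast0LessThan)
  have "S \<le> real q" unfolding S_def sum by (rule order_trans[OF sum_norm_le[of _ _ "\<lambda>_. 1"]]) auto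
  define X where "X = real q / S"
  have X: "1 \<le> X" using S \<open>S \<le> real q\<close> by (simp add: X_def)
  have "real q / X \<le> S" using S q by (simp add: X_def)
  then obtain r where r: "1 \<le> r" "real r \<le> A * X ^ B"
    "near_int (A * X ^ B / real q ^ k) (real r * (of_int p / of_nat q))"
    using inverse[of q X q 0 "of_int p / of_nat q"] q X by (auto simp: S_def sum)
  obtain a :: int where a: "\<bar>real r * (of_int p / of_nat q) - of_int a\<bar> \<le> A * X ^ B / real q ^ k"
    using r(3) by (auto simp: near_int_def)
  have "real q \<le> A * X ^ B"
  proof (cases "int r * p = a * int q")
    case True
    then have "int q dvd int r * p" by simp
    then have "int q dvd int r" using cop by (simp add: coprime_dvd_mult_left_iff coprime_commute)
    then have "q \<le> r" using r(1) by (auto dest: dvd_imp_le)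
    then show ?thesis using r(2) by linarith
  next
    case False
    then have "1 \<le> \<bar>int r * p - a * int q\<bar>" by linarith
    then have "1 \<le> \<bar>real_of_int (int r * p - a * int q)\<bar>" by linarith
    also have "\<dots> = \<bar>real r * (of_int p / of_nat q) - of_int a\<bar> * real q"
    proof -
      have "real_of_int (int r * p - a * int q) = (real r * (of_int p / of_nat q) - of_int a) * real q"
        using q by (simp add: field_simps)
      then show ?thesis by (simp only: abs_mult abs_of_nat)
    qed
    also have "\<dots> \<le> A * X ^ B / real q ^ k * real q" using a by (intro mult_right_mono) auto
    also have "\<dots> \<le> A * X ^ B / real q ^ 2 * real q"
      using k q A X by (intro mult_right_mono divide_left_mono power_increasing) auto
    finally show ?thesis using q by (simp add: field_simps power2_eq_square)
  qed
  then have "1 / X \<le> A * real q powr (- 1 / real B)"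
    using q X A B by (intro inverse_root_bound) auto
  also have "- 1 / real B = - 4 * \<eta>" using \<eta>(3) by simp
  also have "1 / X = S / real q" by (simp add: X_def)
  finally show ?thesis using q by (simp add: S_def field_simps)
qed (use A in simp)

end

section \<open>The contribution of one convergent\<close>

context monomial_weyl
begin

definition minor_const :: real where
  "minor_const = 4 * A ^ 2 * (1 + 4 / \<eta> + 1 / (1 - 2 powr (- 2 * \<eta>)))"

definition major_const :: real where
  "major_const = 2 + 16 * 4 ^ k + 8 * 2 ^ k * A"

definition scale_const :: real where
  "scale_const = major_const + minor_const + A * (2 + 3 / \<eta>)"

lemma minor_const_nonneg: "0 \<le> minor_const"
proof -
  have "2 powr (- 2 * \<eta>) < 1" using \<eta>(1) by (intro powr_less_one) auto
  then show ?thesis using \<eta>(1) by (auto simp: minor_const_def intro!: mult_nonneg_nonneg add_nonneg_nonneg)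
qed

lemma scale_const_nonneg: "0 \<le> scale_const"
  using minor_const_nonneg A \<eta>(1) by (simp add: scale_const_def major_const_def)

end

text \<open>One reduced fraction \<open>p / q\<close> together with the denominator \<open>Q\<close> that measures how well it approximates
\<open>x\<close>: two consecutive convergents have this property.  The indices \<open>n\<close> from \<open>q\<^sup>2\<close> to \<open>Q\<^sup>2\<close> are treated
here with errors bounded by a fixed multiple of a negative power of \<open>q\<close>.\<close>

locale rational_scale = monomial_weyl +
  fixes x :: real and r :: rat and p :: int and q Q :: nat
  assumes r: "quotient_of r = (p, int q)" and qQ: "q \<le> Q"
    and lower: "1 / (2 * real q * real Q) \<le> \<bar>x - of_int p / of_nat q\<bar>"
    and upper: "\<bar>x - of_int p / of_nat q\<bar> \<le> 1 / (real q * real Q)"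
begin

lemma q: "1 \<le> q" and Q: "1 \<le> Q" and cop: "coprime p (int q)"
  using quotient_of_denom_pos[OF r] quotient_of_coprime[OF r] qQ by auto

text \<open>The average of \<open>e(n\<^sup>k p / q)\<close> over a period.\<close>

definition mean :: complex where "mean = gauss_sum k r / of_nat q"

lemma norm_mean_le: "cmod mean \<le> A * real q powr (- 4 * \<eta>)"
  using gauss_sum_bound[OF r] q by (simp add: mean_def norm_divide field_simps)

lemma norm_mean_le_1: "cmod mean \<le> 1"
proof -
  have "cmod (gauss_sum k r) \<le> (\<Sum>t<q. 1)"
    unfolding gauss_sum_nat[OF r] by (rule sum_norm_le) auto
  then show ?thesis using q by (simp add: mean_def norm_divide)
qed

text \<open>This is \<open>Q\<^sup>1\<^sup>/\<^sup>k\<close> rounded up.  Since \<open>|x - p / q|\<close> is about \<open>1 / (q Q)\<close>, the factor \<open>e(n\<^sup>k (x - p / q))\<close>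
has bounded variation up to this point, so that \<open>e(n\<^sup>k x)\<close> follows the periodic function \<open>e(n\<^sup>k p / q)\<close>;
beyond this point \<open>M\<^sup>k \<ge> Q\<close>, and the inverse theorem provides cancellation.\<close>

definition cutoff :: nat where "cutoff = (LEAST R. Q \<le> R ^ k)"

lemma cutoff: "Q \<le> cutoff ^ k" "cutoff \<le> Q" "1 \<le> cutoff" "cutoff ^ k \<le> 2 ^ k * Q"
proof -
  have Qk: "Q \<le> Q ^ k" using Q k by (simp add: self_le_power)
  show c1: "Q \<le> cutoff ^ k" unfolding cutoff_def by (rule LeastI) (rule Qk)
  show "cutoff \<le> Q" unfolding cutoff_def by (rule Least_le) (rule Qk)
  show c3: "1 \<le> cutoff"
  proof (rule ccontr)
    assume "\<not> 1 \<le> cutoff"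
    then have "cutoff = 0" by simp
    then show False using c1 Q k by (simp add: zero_power)
  qed
  show "cutoff ^ k \<le> 2 ^ k * Q"
  proof (cases "cutoff = 1")
    case True then show ?thesis using Q by (simp add: one_le_mult_iff)
  next
    case False
    have "\<not> Q \<le> (cutoff - 1) ^ k"
      using c3 not_less_Least[of "cutoff - 1" "\<lambda>R. Q \<le> R ^ k"] by (simp add: cutoff_def)
    moreover have "cutoff ^ k \<le> (2 * (cutoff - 1)) ^ k" using c3 False by (intro power_mono) auto
    ultimately show ?thesis by (simp add: power_mult_distrib)
      (meson le_trans less_imp_le mult_le_mono2 not_le)
  qed
qed

lemma real_cutoff: "real Q \<le> real cutoff ^ k" "real cutoff ^ k \<le> 2 ^ k * real Q"
proof -
  have "real Q \<le> real (cutoff ^ k)" "real (cutoff ^ k) \<le> real (2 ^ k * Q)"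
    using cutoff(1,4) by (simp_all only: of_nat_le_iff)
  then show "real Q \<le> real cutoff ^ k" "real cutoff ^ k \<le> 2 ^ k * real Q" by simp_all
qed

text \<open>What the conclusion of the inverse theorem means in terms of \<open>q\<close> and \<open>Q\<close>.  Suppose \<open>n \<le> Y < Q / 2\<close> and
\<open>n x\<close> is within \<open>Y / M\<^sup>k\<close> of the integer \<open>a\<close>.  If \<open>a / n = p / q\<close>, then \<open>q\<close> divides \<open>n\<close> and the distance
is at least \<open>q |x - p / q| \<ge> 1 / (2 Q)\<close>.  Otherwise \<open>a / n\<close> and \<open>p / q\<close> differ by at least \<open>1 / (n q)\<close>,
of which the approximation error of \<open>x\<close> uses up at most half, and the distance is at least
\<open>1 / (2 q)\<close>, so that \<open>q\<^sup>2 \<le> M\<^sup>k \<le> 2 q Y\<close>.  In both cases \<open>q \<le> 2 Y\<close> and \<open>M\<^sup>k \<le> 2 Q Y\<close>, and the product of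
these bounds is the second alternative.\<close>

lemma short_sum_dichotomy:
  assumes M: "q ^ 2 \<le> M ^ k" and r1: "1 \<le> n" and nY: "real n \<le> Y"
    and near: "near_int (Y / real M ^ k) (real n * x)"
  shows "real Q \<le> 2 * Y \<or> real q * real M ^ k / real Q \<le> 4 * Y ^ 2"
proof (rule disjCI)
  assume "\<not> real q * real M ^ k / real Q \<le> 4 * Y ^ 2"
  show "real Q \<le> 2 * Y"
  proof (rule ccontr)
    assume *: "\<not> real Q \<le> 2 * Y"
    define \<theta> where "\<theta> = x - of_int p / of_nat q"
    have Mk: "0 < real M ^ k" using M q k by (cases M) (auto simp: zero_power)
    have Y: "1 \<le> Y" using r1 nY by linarith
    obtain a :: int where a: "\<bar>real n * x - of_int a\<bar> \<le> Y / real M ^ k"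
      using near by (auto simp: near_int_def)
    have "real q \<le> 2 * Y \<and> real M ^ k \<le> 2 * real Q * Y"
    proof (cases "int n * p = a * int q")
      case True
      then have "int q dvd int n * p" by simp
      then have "int q dvd int n" using cop by (simp add: coprime_dvd_mult_left_iff coprime_commute)
      then have qn: "q \<le> n" using r1 by (auto dest: dvd_imp_le)
      have "real_of_int (int n * p) = real_of_int (a * int q)" using True by simp
      then have "real n * x - of_int a = real n * \<theta>"
        using q by (simp add: \<theta>_def field_simps)
      then have "real n * \<bar>\<theta>\<bar> \<le> Y / real M ^ k" using a by (simp add: abs_mult)
      moreover have "real q * (1 / (2 * real q * real Q)) \<le> real n * \<bar>\<theta>\<bar>"
        using qn lower unfolding \<theta>_def by (intro mult_mono) auto
      moreover have "real q * (1 / (2 * real q * real Q)) = 1 / (2 * real Q)" using q by simp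
      ultimately have "1 / (2 * real Q) \<le> Y / real M ^ k" by linarith
      then have "real M ^ k \<le> 2 * real Q * Y" using Q Mk by (simp add: field_simps)
      moreover have "real q \<le> Y" using qn nY by linarith
      ultimately show ?thesis using Y by linarith
    next
      case False
      have eq: "real n * x - of_int a = of_int (int n * p - a * int q) / real q + real n * \<theta>"
        using q by (simp add: \<theta>_def field_simps)
      have "1 \<le> \<bar>int n * p - a * int q\<bar>" using False by linarith
      then have "1 \<le> \<bar>real_of_int (int n * p - a * int q)\<bar>" by linarith
      then have "1 / real q \<le> \<bar>of_int (int n * p - a * int q) / real q\<bar>"
        using q by (simp add: abs_divide divide_right_mono del: of_int_diff)
      moreover have "\<bar>real n * \<theta>\<bar> \<le> 1 / (2 * real q)"
      proof -
        have "\<bar>real n * \<theta>\<bar> \<le> (real Q / 2) * (1 / (real q * real Q))"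
          unfolding abs_mult using nY * upper by (intro mult_mono) (auto simp: \<theta>_def)
        then show ?thesis using Q by simp
      qed
      moreover have "1 / real q - 1 / (2 * real q) = 1 / (2 * real q)" using q by (simp add: field_simps)
      moreover define t where "t = real_of_int (int n * p - a * int q) / real q"
      ultimately have "1 / real q \<le> \<bar>t\<bar>" "\<bar>real n * \<theta>\<bar> \<le> 1 / (2 * real q)"
        "1 / real q - 1 / (2 * real q) = 1 / (2 * real q)" by auto
      moreover have "\<bar>t + real n * \<theta>\<bar> \<le> Y / real M ^ k" using a eq by (simp only: t_def)
      ultimately have "1 / (2 * real q) \<le> Y / real M ^ k" by linarith
      then have le: "real M ^ k \<le> 2 * real q * Y" using q Mk by (simp add: field_simps)
      have "real q ^ 2 \<le> real M ^ k" using M by (metis of_nat_le_iff of_nat_power)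
      then have "real q * real q \<le> real q * (2 * Y)" using le by (simp add: power2_eq_square)
      then have "real q \<le> 2 * Y" using q by simp
      moreover have "2 * real q * Y \<le> 2 * real Q * Y" using qQ Y by (intro mult_right_mono) auto
      ultimately show ?thesis using le by linarith
    qed
    then have "real q * real M ^ k \<le> (2 * Y) * (2 * real Q * Y)" using Y by (intro mult_mono) auto
    then have "real q * real M ^ k / real Q \<le> 4 * Y ^ 2"
      using Q by (simp add: field_simps power2_eq_square)
    then show False using \<open>\<not> real q * real M ^ k / real Q \<le> 4 * Y ^ 2\<close> by simp
  qed
qed

text \<open>The saving in the second term combines a power of \<open>q\<close> with a power of \<open>M\<^sup>k / Q\<close>.  The power of \<open>q\<close>
makes the errors summable over all convergents, the other one makes them summable over dyadic
values of \<open>M\<close> beyond the cutoff.\<close>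

lemma short_sum_bound:
  assumes M: "q ^ 2 \<le> M ^ k" "1 \<le> M" and len: "v - u \<le> M"
  shows "cmod (\<Sum>n\<in>{u..<v}. unit_exp (of_nat n ^ k * x))
    \<le> real M * (4 * A ^ 2 * (real Q powr (- 2 * \<eta>) + (real q * real M ^ k / real Q) powr (- 2 * \<eta>)))"
    (is "?S \<le> real M * (_ * (?U + ?V))")
proof (cases "?S = 0")
  case True then show ?thesis by simp
next
  case False
  then have S: "0 < ?S" by (metis norm_ge_zero less_eq_real_def)
  define X where "X = real M / ?S"
  have "?S \<le> (\<Sum>n\<in>{u..<v}. 1)" by (rule sum_norm_le) auto
  then have "?S \<le> real M" using len by simp
  then have X: "1 \<le> X" using S by (simp add: X_def)
  have "real M / X \<le> ?S" using S M by (simp add: X_def)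
  then obtain n where n: "1 \<le> n" "real n \<le> A * X ^ B" "near_int (A * X ^ B / real M ^ k) (real n * x)"
    using inverse[of M X v u x] M X len by blast
  have A2: "2 * A \<le> 4 * A ^ 2" using A self_le_power[of A 2] by simp
  have UV: "0 \<le> ?U" "0 \<le> ?V" by auto
  have A0: "0 \<le> 4 * A ^ 2" by simp
  have "1 / X \<le> 4 * A ^ 2 * (?U + ?V)"
    using short_sum_dichotomy[OF M(1) n]
  proof
    assume "real Q \<le> 2 * (A * X ^ B)"
    then have "1 / X \<le> (2 * A) * real Q powr (- 1 / real B)"
      using Q X A B by (intro inverse_root_bound) auto
    also have "- 1 / real B = - 4 * \<eta>" using \<eta>(3) by simp
    also have "(2 * A) * real Q powr (- 4 * \<eta>) \<le> (4 * A ^ 2) * ?U"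
      using Q \<eta>(1) by (intro mult_mono[OF A2] powr_mono) auto
    also have "\<dots> \<le> 4 * A ^ 2 * (?U + ?V)" using UV A0 by (intro mult_left_mono) auto
    finally show ?thesis .
  next
    assume *: "real q * real M ^ k / real Q \<le> 4 * (A * X ^ B) ^ 2"
    have "4 * (A * X ^ B) ^ 2 = 4 * A ^ 2 * X ^ (2 * B)"
      by (simp add: power_mult_distrib power_mult[symmetric] mult.commute)
    moreover have "1 \<le> 4 * A ^ 2" using A one_le_power[of A 2] by linarith
    ultimately have "1 / X \<le> (4 * A ^ 2) * (real q * real M ^ k / real Q) powr (- 1 / real (2 * B))"
      using Q q M X B * by (intro inverse_root_bound) auto
    also have "- 1 / real (2 * B) = - 2 * \<eta>" using \<eta>(4) by simp
    also have "(4 * A ^ 2) * ?V \<le> 4 * A ^ 2 * (?U + ?V)" using UV A0 by (intro mult_left_mono) auto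
    finally show ?thesis .
  qed
  then have "real M * (1 / X) \<le> real M * (4 * A ^ 2 * (?U + ?V))" by (intro mult_left_mono) auto
  moreover have "real M * (1 / X) = ?S" using M by (simp add: X_def)
  ultimately show ?thesis by simp
qed

lemma dyadic_block_bound:
  assumes M: "q ^ 2 \<le> M" "cutoff \<le> M" and i: "2 ^ i * M \<le> M'" and N: "M' \<le> N" "N \<le> 2 * M'"
  shows "cmod (\<Sum>n\<in>{M'<..N}. F_term k x n)
    \<le> 4 * A ^ 2 * (real Q powr (- 2 * \<eta>) + real q powr (- 2 * \<eta>) * (2 powr (- 2 * \<eta>)) ^ i)"
proof -
  have M1: "1 \<le> M" using M(2) cutoff(3) by linarith
  have MM': "M \<le> M'" 
  proof -
    have "1 * M \<le> 2 ^ i * M" by (rule mult_le_mono1) simp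
    then show ?thesis using i by linarith
  qed
  have qM': "q ^ 2 \<le> M' ^ k"
    using M(1) MM' M1 k self_le_power[of M' k] by linarith
  have key: "real q * 2 ^ i \<le> real q * real M' ^ k / real Q"
  proof -
    have "2 ^ i * Q \<le> 2 ^ i * M ^ k" using cutoff(1) M(2) power_mono[of cutoff M k] by simp
    also have "\<dots> \<le> (2 ^ i) ^ k * M ^ k" using k self_le_power[of "2 ^ i :: nat" k] by (intro mult_right_mono) auto
    also have "\<dots> \<le> M' ^ k" unfolding power_mult_distrib[symmetric] using i by (intro power_mono) auto
    finally have "real (2 ^ i * Q) \<le> real (M' ^ k)" by (simp only: of_nat_le_iff)
    then have "2 ^ i \<le> real M' ^ k / real Q" using Q by (simp add: field_simps)
    then show ?thesis using mult_left_mono[of "2 ^ i" "real M' ^ k / real Q" "real q"] by simp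
  qed
  let ?E = "4 * A ^ 2 * (real Q powr (- 2 * \<eta>) + (real q * real M' ^ k / real Q) powr (- 2 * \<eta>))"
  have "cmod (\<Sum>n\<in>{M'<..m}. unit_exp (of_nat n ^ k * x)) \<le> real M' * ?E" if "M' \<le> m" "m \<le> N" for m
  proof -
    have "{M'<..m} = {Suc M'..<Suc m}" by auto
    then show ?thesis using short_sum_bound[of M' "Suc m" "Suc M'"] qM' MM' M1 that N by simp
  qed
  then have "cmod (\<Sum>n\<in>{M'<..N}. unit_exp (of_nat n ^ k * x) / of_nat n) \<le> real M' * ?E / real M'"
    using N(1) MM' M1 by (intro norm_sum_over_n_le) auto
  also have "\<dots> = ?E" using MM' M1 by simp
  also have "\<dots> \<le> 4 * A ^ 2 * (real Q powr (- 2 * \<eta>) + (real q * 2 ^ i) powr (- 2 * \<eta>))"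
    using key q \<eta>(1) by (intro mult_left_mono add_left_mono powr_mono2') auto
  also have "(real q * 2 ^ i) powr (- 2 * \<eta>) = real q powr (- 2 * \<eta>) * (2 powr (- 2 * \<eta>)) ^ i"
    using q by (simp add: powr_mult powr_powr powr_realpow[symmetric] mult.commute)
  finally show ?thesis by (simp add: F_term_def)
qed

lemma dyadic_sum_bound:
  assumes M: "q ^ 2 \<le> M" "cutoff \<le> M"
  shows "M \<le> N \<Longrightarrow> N \<le> 2 ^ I * M \<Longrightarrow> cmod (\<Sum>n\<in>{M<..N}. F_term k x n)
    \<le> (\<Sum>i<I. 4 * A ^ 2 * (real Q powr (- 2 * \<eta>) + real q powr (- 2 * \<eta>) * (2 powr (- 2 * \<eta>)) ^ i))"
    (is "_ \<Longrightarrow> _ \<Longrightarrow> _ \<le> sum ?f _")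
proof (induction I arbitrary: N)
  case (Suc I)
  have f0: "0 \<le> ?f i" for i by simp
  show ?case
  proof (cases "N \<le> 2 ^ I * M")
    case True
    then have "cmod (\<Sum>n\<in>{M<..N}. F_term k x n) \<le> sum ?f {..<I}" using Suc by blast
    then show ?thesis using f0[of I] unfolding sum.lessThan_Suc by linarith
  next
    case False
    define M' where "M' = 2 ^ I * M"
    have MM': "M \<le> M'" by (simp add: M'_def)
    have "{M<..N} = {M<..M'} \<union> {M'<..N}" using False MM' unfolding M'_def[symmetric] by auto
    then have "(\<Sum>n\<in>{M<..N}. F_term k x n) = (\<Sum>n\<in>{M<..M'}. F_term k x n) + (\<Sum>n\<in>{M'<..N}. F_term k x n)"
      by (simp add: sum.union_disjoint)
    then have "cmod (\<Sum>n\<in>{M<..N}. F_term k x n)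
        \<le> cmod (\<Sum>n\<in>{M<..M'}. F_term k x n) + cmod (\<Sum>n\<in>{M'<..N}. F_term k x n)"
      by (simp add: norm_triangle_ineq)
    also have "\<dots> \<le> sum ?f {..<I} + ?f I"
      using False Suc.prems MM'
      by (intro add_mono Suc.IH dyadic_block_bound[OF M]) (auto simp: M'_def)
    finally show ?thesis by simp
  qed
qed simp

text \<open>Beyond the cutoff the dyadic blocks contribute \<open>q\<^sup>-\<^sup>2\<^sup>\<eta>\<close> times a geometric series, plus one term of size
\<open>Q\<^sup>-\<^sup>2\<^sup>\<eta>\<close> for each of the \<open>O(1 + ln Q)\<close> blocks below \<open>Q\<^sup>2\<close>.\<close>

lemma minor_range_bound:
  assumes M: "q ^ 2 \<le> M" "cutoff \<le> M" and N: "M \<le> N" "N \<le> Q ^ 2"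
  shows "cmod (\<Sum>n\<in>{M<..N}. F_term k x n) \<le> minor_const * real q powr (- \<eta>)"
proof -
  define I where "I = nat \<lceil>log 2 (real Q ^ 2)\<rceil>"
  define \<rho> :: real where "\<rho> = 2 powr (- 2 * \<eta>)"
  have \<rho>: "0 \<le> \<rho>" "\<rho> < 1" unfolding \<rho>_def using \<eta>(1) by (auto intro: powr_less_one)
  have logQ: "0 \<le> log 2 (real Q ^ 2)" using Q by (simp add: zero_le_log_cancel_iff)
  have "log 2 (real Q ^ 2) \<le> real I" unfolding I_def by linarith
  then have "real Q ^ 2 \<le> 2 ^ I" using Q by (simp add: log_le_iff powr_realpow)
  then have "real (Q ^ 2) \<le> real (2 ^ I)" by simp
  then have QI: "Q ^ 2 \<le> 2 ^ I" by (simp only: of_nat_le_iff)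
  have "1 \<le> M" using M(2) cutoff(3) by linarith
  then have NI: "N \<le> 2 ^ I * M" using N(2) QI by (metis le_trans mult.right_neutral mult_le_mono2)
  have I_le: "real I \<le> 1 + 4 * ln (real Q)"
  proof -
    have "real I \<le> log 2 (real Q ^ 2) + 1" using logQ unfolding I_def by linarith
    also have "log 2 (real Q ^ 2) = 2 * (ln (real Q) / ln 2)"
      using Q by (simp add: log_def ln_realpow)
    also have "ln (real Q) / ln 2 \<le> ln (real Q) / (1/2)"
      using Q ln2_ge_two_thirds by (intro divide_left_mono) auto
    finally show ?thesis by simp
  qed
  have IQ: "real I * real Q powr (- 2 * \<eta>) \<le> (1 + 4 / \<eta>) * real q powr (- \<eta>)"
  proof -
    have "ln (real Q) \<le> real Q powr \<eta> / \<eta>" using Q \<eta>(1) by (intro ln_powr_bound) auto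
    moreover have Q1: "1 \<le> real Q powr \<eta>" using Q \<eta>(1) by (intro ge_one_powr_ge_zero) auto
    ultimately have "real I \<le> (1 + 4 / \<eta>) * real Q powr \<eta>" using I_le by (simp add: algebra_simps)
    then have "real I * real Q powr (- 2 * \<eta>) \<le> (1 + 4 / \<eta>) * real Q powr \<eta> * real Q powr (- 2 * \<eta>)"
      by (intro mult_right_mono) auto
    also have "\<dots> = (1 + 4 / \<eta>) * real Q powr (- \<eta>)" by (simp add: mult.assoc powr_add[symmetric])
    also have "\<dots> \<le> (1 + 4 / \<eta>) * real q powr (- \<eta>)"
      using q qQ \<eta>(1) by (intro mult_left_mono powr_mono2') auto
    finally show ?thesis .
  qed
  have geo: "(\<Sum>i<I. \<rho> ^ i) \<le> 1 / (1 - \<rho>)"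
    using \<rho> by (simp add: sum_gp_strict divide_right_mono)
  have "cmod (\<Sum>n\<in>{M<..N}. F_term k x n)
      \<le> (\<Sum>i<I. 4 * A ^ 2 * (real Q powr (- 2 * \<eta>) + real q powr (- 2 * \<eta>) * \<rho> ^ i))"
    unfolding \<rho>_def by (rule dyadic_sum_bound[OF M N(1) NI])
  also have "\<dots> = 4 * A ^ 2 * (real I * real Q powr (- 2 * \<eta>) + real q powr (- 2 * \<eta>) * (\<Sum>i<I. \<rho> ^ i))"
    by (simp add: sum_distrib_left[symmetric] sum.distrib)
  also have "\<dots> \<le> 4 * A ^ 2 * ((1 + 4 / \<eta>) * real q powr (- \<eta>) + real q powr (- \<eta>) * (1 / (1 - \<rho>)))"
    using geo q \<eta>(1) \<rho>
    by (intro mult_left_mono add_mono[OF IQ] mult_mono[OF powr_mono] sum_nonneg) auto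
  also have "\<dots> = minor_const * real q powr (- \<eta>)" by (simp add: minor_const_def \<rho>_def algebra_simps)
  finally show ?thesis .
qed

lemma q_powr: "1 / real q \<le> real q powr (- \<eta>)"
proof -
  have "1 / real q = real q powr (- 1)" using q by (simp add: powr_minus_divide)
  also have "\<dots> \<le> real q powr (- \<eta>)" using q \<eta>(2) by (intro powr_mono) auto
  finally show ?thesis .
qed

lemma mean_powr: "cmod mean \<le> A * real q powr (- \<eta>)"
proof -
  have "real q powr (- 4 * \<eta>) \<le> real q powr (- \<eta>)" using q \<eta>(1) by (intro powr_mono) auto
  then show ?thesis using norm_mean_le A mult_left_mono[of "real q powr (- 4 * \<eta>)" "real q powr (- \<eta>)" A]
    by linarith
qed

text \<open>Write \<open>e(n\<^sup>k x) = (g n + mean) w n\<close>, where \<open>g\<close> is periodic with mean value zero and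
\<open>w n = e(\<theta> n\<^sup>k)\<close> for \<open>\<theta> = x - p / q\<close>.  The partial sums of \<open>g\<close> are \<open>O(q)\<close> and \<open>w\<close> has bounded variation,
so summation from \<open>q\<^sup>2\<close> on with weight \<open>1 / n\<close> leaves \<open>O(1 / q)\<close>.  In the second part, replacing \<open>w\<close>
by \<open>1\<close> costs \<open>O(1)\<close>, which is multiplied by the small number \<open>mean\<close>.\<close>

lemma major_range_approx:
  assumes N: "q ^ 2 \<le> N" "N \<le> cutoff"
  shows "cmod ((\<Sum>n\<in>{q ^ 2<..N}. F_term k x n) - mean * of_real (\<Sum>n\<in>{q ^ 2<..N}. 1 / real n))
    \<le> major_const * real q powr (- \<eta>)"
proof -
  define \<theta> where "\<theta> = x - of_int p / of_nat q"
  define g where "g n = unit_exp (of_nat n ^ k * (of_int p / of_nat q)) - mean" for n :: nat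
  define w where "w n = unit_exp (\<theta> * of_nat n ^ k)" for n :: nat
  have w1: "cmod (w n) = 1" for n by (simp add: w_def)
  have \<theta>Q: "\<bar>\<theta>\<bar> * real Q \<le> 1 / real q"
    using upper Q q by (simp add: \<theta>_def field_simps)
  have "1 / real q \<le> 1" using q by simp
  have qq: "1 \<le> q ^ 2" using q by simp
  have cut: "real cutoff ^ k \<le> 2 ^ k * real Q"
    by (rule real_cutoff(2))
  have cutpow: "\<bar>\<theta>\<bar> * real n ^ k \<le> c ^ k * 2 ^ k" if "real n \<le> c * real cutoff" "0 \<le> c" for n c
  proof -
    have "\<bar>\<theta>\<bar> * real n ^ k \<le> \<bar>\<theta>\<bar> * (c * real cutoff) ^ k"
      using that by (intro mult_left_mono power_mono) auto
    also have "\<dots> \<le> \<bar>\<theta>\<bar> * (c ^ k * (2 ^ k * real Q))"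
      unfolding power_mult_distrib using cut that by (intro mult_left_mono) auto
    also have "\<dots> = c ^ k * 2 ^ k * (\<bar>\<theta>\<bar> * real Q)" by simp
    also have "\<dots> \<le> c ^ k * 2 ^ k * 1" using \<theta>Q \<open>1 / real q \<le> 1\<close> that by (intro mult_left_mono) auto
    finally show ?thesis by simp
  qed
  have F_split: "F_term k x n = g n * w n / of_nat n + mean * ((w n - 1) / of_nat n) + mean * of_real (1 / real n)" for n
  proof -
    have "of_nat n ^ k * x = of_nat n ^ k * (of_int p / of_nat q) + \<theta> * of_nat n ^ k"
      by (simp add: \<theta>_def algebra_simps)
    then have "unit_exp (of_nat n ^ k * x) = (g n + mean) * w n"
      by (simp only: unit_exp_add g_def w_def) simp
    then show ?thesis by (simp add: F_term_def add_divide_distrib[symmetric] diff_divide_distrib algebra_simps)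
  qed
  have g_sum: "cmod (\<Sum>n\<in>{a<..b}. g n) \<le> 2 * real q" for a b
  proof (rule norm_periodic_sum_le[OF _ _ q])
    show "g (n + q) = g n" for n using unit_exp_power_periodic[OF q] by (simp add: g_def)
    show "(\<Sum>n<q. g n) = 0" using q gauss_sum_nat[OF r, of k] by (simp add: g_def sum_subtractf mean_def)
    show "cmod (g n) \<le> 2" for n
      unfolding g_def using norm_mean_le_1 norm_triangle_ineq4[of _ mean]
      by (smt (verit) norm_unit_exp)
  qed
  have gw: "cmod (\<Sum>n\<in>{q ^ 2<..m}. g n * w n) \<le> 2 * real q * (1 + 8 * 4 ^ k)" if m: "q ^ 2 \<le> m" "m \<le> N" for m
  proof -
    have "(\<Sum>n\<in>{q ^ 2<..m}. cmod (w n - w (Suc n)))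
        \<le> (\<Sum>n\<in>{q ^ 2<..m}. 2 * pi * \<bar>\<theta>\<bar> * (real (Suc n) ^ k - real n ^ k))"
    proof (rule sum_mono)
      fix n
      have "cmod (w n - w (Suc n)) \<le> 2 * pi * \<bar>\<theta> * real n ^ k - \<theta> * real (Suc n) ^ k\<bar>"
        unfolding w_def by (rule norm_unit_exp_diff_le)
      also have "\<dots> = 2 * pi * (\<bar>\<theta>\<bar> * \<bar>real n ^ k - real (Suc n) ^ k\<bar>)"
        by (simp only: abs_mult[symmetric] right_diff_distrib)
      also have "\<bar>real n ^ k - real (Suc n) ^ k\<bar> = real (Suc n) ^ k - real n ^ k"
        using power_mono[of "real n" "real (Suc n)" k] by simp
      finally show "cmod (w n - w (Suc n)) \<le> 2 * pi * \<bar>\<theta>\<bar> * (real (Suc n) ^ k - real n ^ k)"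
        by (simp add: mult.assoc)
    qed
    also have "\<dots> = 2 * pi * \<bar>\<theta>\<bar> * (real (Suc m) ^ k - real (Suc (q ^ 2)) ^ k)"
      unfolding sum_distrib_left[symmetric]
    proof (rule arg_cong[of _ _ "\<lambda>t. 2 * pi * \<bar>\<theta>\<bar> * t"])
      show "(\<Sum>n\<in>{q ^ 2<..m}. real (Suc n) ^ k - real n ^ k) = real (Suc m) ^ k - real (Suc (q ^ 2)) ^ k"
        using m(1)
      proof (induction m rule: dec_induct)
        case (step m)
        then have "{q ^ 2<..Suc m} = insert (Suc m) {q ^ 2<..m}" by auto
        then show ?case using step by simp
      qed simp
    qed
    also have "\<dots> \<le> 2 * pi * \<bar>\<theta>\<bar> * real (Suc m) ^ k" by (intro mult_left_mono) auto
    also have "\<dots> = 2 * pi * (\<bar>\<theta>\<bar> * real (Suc m) ^ k)" by simp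
    also have "\<dots> \<le> 2 * 4 * (2 ^ k * 2 ^ k)"
    \<comment> \<open>Summation by parts reaches \<open>m + 1\<close>, which is at most twice the cutoff; this is the origin of \<open>4\<^sup>k\<close>.\<close>
    proof (rule mult_mono)
      show "\<bar>\<theta>\<bar> * real (Suc m) ^ k \<le> 2 ^ k * 2 ^ k" using m N cutoff(3) by (intro cutpow) auto
    qed (use pi_less_4 in auto)
    also have "(2::real) ^ k * 2 ^ k = 4 ^ k" by (simp add: power_mult_distrib[symmetric])
    finally have var: "(\<Sum>n\<in>{q ^ 2<..m}. cmod (w n - w (Suc n))) \<le> 8 * 4 ^ k" by simp
    have "cmod (\<Sum>n\<in>{q ^ 2<..m}. g n * w n)
        \<le> 2 * real q * (cmod (w (Suc m)) + (\<Sum>n\<in>{q ^ 2<..m}. cmod (w n - w (Suc n))))"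
      by (rule norm_sum_times_variation_le[OF m(1)]) (rule g_sum)
    also have "\<dots> \<le> 2 * real q * (1 + 8 * 4 ^ k)" using var w1 by (intro mult_left_mono) auto
    finally show ?thesis .
  qed
  have first: "cmod (\<Sum>n\<in>{q ^ 2<..N}. g n * w n / of_nat n) \<le> (2 + 16 * 4 ^ k) * real q powr (- \<eta>)"
  proof -
    have "cmod (\<Sum>n\<in>{q ^ 2<..N}. g n * w n / of_nat n) \<le> 2 * real q * (1 + 8 * 4 ^ k) / real (q ^ 2)"
      by (rule norm_sum_over_n_le[OF N(1) qq gw])
    also have "\<dots> = (2 + 16 * 4 ^ k) * (1 / real q)" using q by (simp add: power2_eq_square field_simps)
    also have "\<dots> \<le> (2 + 16 * 4 ^ k) * real q powr (- \<eta>)" using q_powr by (intro mult_left_mono) auto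
    finally show ?thesis .
  qed
  have pow_k: "z ^ k = z ^ (k - 1) * z" for z :: real
    using k power_Suc2[of z "k - 1"] by simp
  have second: "cmod (\<Sum>n\<in>{q ^ 2<..N}. (w n - 1) / of_nat n) \<le> 8 * 2 ^ k"
  proof -
    have "cmod (\<Sum>n\<in>{q ^ 2<..N}. (w n - 1) / of_nat n) \<le> (\<Sum>n\<in>{q ^ 2<..N}. 8 * 2 ^ k / real N)"
    proof (rule sum_norm_le)
      fix n assume n: "n \<in> {q ^ 2<..N}"
      then have n1: "0 < real n" by auto
      have "cmod (w n - 1) \<le> 2 * pi * \<bar>\<theta> * real n ^ k - 0\<bar>"
        using norm_unit_exp_diff_le[of "\<theta> * real n ^ k" 0] by (simp add: w_def)
      also have "\<dots> = 2 * pi * (\<bar>\<theta>\<bar> * real n ^ (k - 1)) * real n"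
        by (simp add: abs_mult pow_k)
      finally have "cmod (w n - 1) / real n \<le> 2 * pi * (\<bar>\<theta>\<bar> * real n ^ (k - 1))"
        using n1 by (simp add: field_simps)
      also have "\<dots> \<le> 2 * pi * (\<bar>\<theta>\<bar> * real N ^ (k - 1))"
        using n by (intro mult_left_mono power_mono) auto
      also have "\<dots> = 2 * pi * (\<bar>\<theta>\<bar> * real N ^ k) / real N"
        using n by (simp add: pow_k)
      also have "\<dots> \<le> 2 * 4 * (1 ^ k * 2 ^ k) / real N"
      proof (rule divide_right_mono, rule mult_mono)
        show "\<bar>\<theta>\<bar> * real N ^ k \<le> 1 ^ k * 2 ^ k" using N by (intro cutpow) auto
      qed (use pi_less_4 in auto)
      finally show "cmod ((w n - 1) / of_nat n) \<le> 8 * 2 ^ k / real N" by (simp add: norm_divide)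
    qed
    also have "\<dots> = real (card {q ^ 2<..N}) * (8 * 2 ^ k / real N)" by simp
    also have "\<dots> \<le> real N * (8 * 2 ^ k / real N)" by (intro mult_right_mono) auto
    also have "\<dots> = 8 * 2 ^ k" using N qq by simp
    finally show ?thesis .
  qed
  have "(\<Sum>n\<in>{q ^ 2<..N}. F_term k x n) - mean * of_real (\<Sum>n\<in>{q ^ 2<..N}. 1 / real n)
      = (\<Sum>n\<in>{q ^ 2<..N}. g n * w n / of_nat n) + mean * (\<Sum>n\<in>{q ^ 2<..N}. (w n - 1) / of_nat n)"
    unfolding F_split sum.distrib sum_distrib_left[symmetric] of_real_sum by simp
  then have "cmod ((\<Sum>n\<in>{q ^ 2<..N}. F_term k x n) - mean * of_real (\<Sum>n\<in>{q ^ 2<..N}. 1 / real n))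
      \<le> cmod (\<Sum>n\<in>{q ^ 2<..N}. g n * w n / of_nat n)
        + cmod mean * cmod (\<Sum>n\<in>{q ^ 2<..N}. (w n - 1) / of_nat n)"
    by (simp only: norm_mult[symmetric] norm_triangle_ineq)
  also have "\<dots> \<le> (2 + 16 * 4 ^ k) * real q powr (- \<eta>) + (A * real q powr (- \<eta>)) * (8 * 2 ^ k)"
    using first second mean_powr A by (intro add_mono mult_mono) auto
  also have "\<dots> = major_const * real q powr (- \<eta>)" by (simp add: major_const_def algebra_simps)
  finally show ?thesis .
qed

text \<open>All that remains of the block is the mean value times a harmonic sum over the range in which
\<open>e(n\<^sup>k x)\<close> imitates \<open>e(n\<^sup>k p / q)\<close>.  This range is empty if the cutoff lies below \<open>q\<^sup>2\<close>.\<close>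

lemma scale_approx:
  assumes N: "q ^ 2 \<le> N" "N \<le> Q ^ 2"
  shows "cmod ((\<Sum>n\<in>{q ^ 2<..N}. F_term k x n) - mean * of_real (\<Sum>n\<in>{q ^ 2<..min N cutoff}. 1 / real n))
    \<le> (major_const + minor_const) * real q powr (- \<eta>)"
proof (cases "N \<le> cutoff")
  case True
  have "0 \<le> minor_const * real q powr (- \<eta>)" using minor_const_nonneg by simp
  then show ?thesis using major_range_approx[OF N(1) True] True by (simp add: min_absorb1 algebra_simps)
next
  case False
  define M where "M = max (q ^ 2) cutoff"
  have minor: "cmod (\<Sum>n\<in>{M<..N}. F_term k x n) \<le> minor_const * real q powr (- \<eta>)"
    using N False by (intro minor_range_bound) (auto simp: M_def)
  have "{q ^ 2<..N} = {q ^ 2<..M} \<union> {M<..N}" using N False by (auto simp: M_def)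
  then have split: "(\<Sum>n\<in>{q ^ 2<..N}. F_term k x n) = (\<Sum>n\<in>{q ^ 2<..M}. F_term k x n) + (\<Sum>n\<in>{M<..N}. F_term k x n)"
    by (simp add: sum.union_disjoint)
  have "cmod ((\<Sum>n\<in>{q ^ 2<..M}. F_term k x n) - mean * of_real (\<Sum>n\<in>{q ^ 2<..cutoff}. 1 / real n))
      \<le> major_const * real q powr (- \<eta>)"
  proof (cases "q ^ 2 \<le> cutoff")
    case True
    then have "M = cutoff" by (simp add: M_def)
    then show ?thesis using major_range_approx[OF True order_refl] by simp
  next
    case False
    then show ?thesis using A by (simp add: M_def major_const_def)
  qed
  then have "cmod (((\<Sum>n\<in>{q ^ 2<..M}. F_term k x n) - mean * of_real (\<Sum>n\<in>{q ^ 2<..cutoff}. 1 / real n))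
      + (\<Sum>n\<in>{M<..N}. F_term k x n)) \<le> major_const * real q powr (- \<eta>) + minor_const * real q powr (- \<eta>)"
    using minor norm_triangle_mono by blast
  then show ?thesis using False unfolding split by (simp add: min_absorb2 algebra_simps)
qed

text \<open>The term of the series over convergents that belongs to \<open>p / q\<close>.\<close>

definition resonance :: complex where
  "resonance = mean * of_real (ln (real Q / real q) / real k)"

text \<open>The harmonic sum is about \<open>ln (cutoff / q\<^sup>2)\<close>, hence \<open>ln (Q / q) / k\<close> up to \<open>O(1 + ln q)\<close>; if the cutoff
is below \<open>q\<^sup>2\<close> both quantities are \<open>O(ln q)\<close>.  The decay of \<open>mean\<close> absorbs this logarithm.\<close>

lemma harmonic_sum_resonance:
  "cmod (mean * of_real (\<Sum>n\<in>{q ^ 2<..cutoff}. 1 / real n) - resonance)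
    \<le> A * (2 + 3 / \<eta>) * real q powr (- \<eta>)"
proof -
  define L where "L = (\<Sum>n\<in>{q ^ 2<..cutoff}. 1 / real n)"
  have lnq: "0 \<le> ln (real q)" "ln (real q) \<le> ln (real Q)" using q qQ by auto
  have lnQ1: "ln (real Q) / real k \<le> ln (real cutoff)"
  proof -
    have "ln (real Q) \<le> ln (real cutoff ^ k)"
      using real_cutoff(1) Q by (intro ln_mono) auto
    then show ?thesis using k cutoff(3) by (simp add: ln_realpow field_simps)
  qed
  have lnQ2: "ln (real cutoff) \<le> 1 + ln (real Q) / real k"
  proof -
    have "real cutoff ^ k \<le> 2 ^ k * real Q"
      by (rule real_cutoff(2))
    then have "ln (real cutoff ^ k) \<le> ln (2 ^ k * real Q)" using cutoff(3) Q by (intro ln_mono) auto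
    then have "real k * ln (real cutoff) \<le> real k * ln 2 + ln (real Q)"
      using cutoff(3) Q by (simp add: ln_realpow ln_mult)
    then have "ln (real cutoff) \<le> ln 2 + ln (real Q) / real k" using k by (simp add: field_simps)
    then show ?thesis using ln_2_less_1 by linarith
  qed
  have ratio: "ln (real Q / real q) / real k = ln (real Q) / real k - ln (real q) / real k"
    using q Q by (simp add: ln_div diff_divide_distrib)
  have qk: "0 \<le> ln (real q) / real k" "ln (real q) / real k \<le> ln (real q)" "ln (real q) / real k \<le> ln (real Q) / real k"
    using lnq k mult_right_mono[of 1 "real k" "ln (real q)"] by (auto simp: field_simps divide_right_mono)
  have ln2: "ln (real (q ^ 2)) = 2 * ln (real q)" using q by (simp add: ln_realpow)
  have "\<bar>L - ln (real Q / real q) / real k\<bar> \<le> 2 + 3 * ln (real q)"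
  proof (cases "q ^ 2 \<le> cutoff")
    case True
    have "\<bar>L - ln (real cutoff / real (q ^ 2))\<bar> \<le> 1"
      unfolding L_def using q True by (intro sum_inverse_approx_ln) auto
    moreover have "ln (real cutoff / real (q ^ 2)) = ln (real cutoff) - 2 * ln (real q)"
      unfolding ln2[symmetric] using q cutoff(3) by (simp add: ln_div)
    ultimately show ?thesis using lnQ1 lnQ2 ratio qk lnq by linarith
  next
    case False
    then have "L = 0" by (simp add: L_def)
    have "ln (real cutoff) \<le> ln (real (q ^ 2))" using False cutoff(3) q by (subst ln_le_cancel_iff) auto
    then show ?thesis using \<open>L = 0\<close> lnQ1 ratio qk lnq ln2 by linarith
  qed
  also have "\<dots> \<le> (2 + 3 / \<eta>) * real q powr \<eta>"
  proof -
    have "ln (real q) \<le> real q powr \<eta> / \<eta>" using q \<eta>(1) by (intro ln_powr_bound) auto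
    moreover have "1 \<le> real q powr \<eta>" using q \<eta>(1) by (intro ge_one_powr_ge_zero) auto
    ultimately show ?thesis by (simp add: algebra_simps)
  qed
  finally have diff: "\<bar>L - ln (real Q / real q) / real k\<bar> \<le> (2 + 3 / \<eta>) * real q powr \<eta>" .
  have "cmod (mean * of_real L - resonance) = cmod mean * \<bar>L - ln (real Q / real q) / real k\<bar>"
    unfolding resonance_def right_diff_distrib[symmetric] of_real_diff[symmetric] norm_mult norm_of_real ..
  also have "\<dots> \<le> (A * real q powr (- 4 * \<eta>)) * ((2 + 3 / \<eta>) * real q powr \<eta>)"
    using norm_mean_le diff A by (intro mult_mono) auto
  also have "\<dots> = A * (2 + 3 / \<eta>) * real q powr (- 3 * \<eta>)" by (simp add: powr_add[symmetric])
  also have "\<dots> \<le> A * (2 + 3 / \<eta>) * real q powr (- \<eta>)"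
    using A q \<eta>(1) by (intro mult_left_mono powr_mono) auto
  finally show ?thesis by (simp add: L_def)
qed

lemma full_scale_approx:
  "cmod ((\<Sum>n\<in>{q ^ 2<..Q ^ 2}. F_term k x n) - resonance) \<le> scale_const * real q powr (- \<eta>)"
proof -
  have "cutoff \<le> Q ^ 2" using cutoff(2) Q self_le_power[of Q 2] by linarith
  then have "cmod ((\<Sum>n\<in>{q ^ 2<..Q ^ 2}. F_term k x n) - mean * of_real (\<Sum>n\<in>{q ^ 2<..cutoff}. 1 / real n))
    \<le> (major_const + minor_const) * real q powr (- \<eta>)"
    using scale_approx[of "Q ^ 2"] qQ by (simp add: min_absorb2)
  from norm_triangle_mono[OF this harmonic_sum_resonance] show ?thesis
    by (simp add: scale_const_def algebra_simps)
qed

text \<open>The harmonic sums increase with \<open>N\<close>, so their value for the whole block dominates those in its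
interior.\<close>

lemma partial_scale_bound:
  assumes N: "q ^ 2 \<le> N" "N \<le> Q ^ 2"
  shows "cmod (\<Sum>n\<in>{q ^ 2<..N}. F_term k x n) \<le> cmod resonance + scale_const * real q powr (- \<eta>)"
proof -
  have "cmod (mean * of_real (\<Sum>n\<in>{q ^ 2<..min N cutoff}. 1 / real n))
      \<le> cmod (mean * of_real (\<Sum>n\<in>{q ^ 2<..cutoff}. 1 / real n))"
  proof -
    have "(\<Sum>n\<in>{q ^ 2<..min N cutoff}. 1 / real n) \<le> (\<Sum>n\<in>{q ^ 2<..cutoff}. 1 / real n)"
      by (intro sum_mono2) auto
    moreover have "0 \<le> (\<Sum>n\<in>{q ^ 2<..min N cutoff}. 1 / real n)" by (intro sum_nonneg) auto
    ultimately show ?thesis unfolding norm_mult norm_of_real by (intro mult_left_mono) auto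
  qed
  also have "\<dots> \<le> cmod resonance + A * (2 + 3 / \<eta>) * real q powr (- \<eta>)"
    using norm_triangle_sub[of "mean * of_real (\<Sum>n\<in>{q ^ 2<..cutoff}. 1 / real n)" resonance]
      harmonic_sum_resonance by linarith
  finally have "cmod (mean * of_real (\<Sum>n\<in>{q ^ 2<..min N cutoff}. 1 / real n))
      \<le> cmod resonance + A * (2 + 3 / \<eta>) * real q powr (- \<eta>)" .
  from norm_triangle_mono[OF scale_approx[OF N] this] show ?thesis
    by (simp add: scale_const_def algebra_simps)
qed

end

section \<open>Continued fractions\<close>

text \<open>Numerators and denominators by the usual recurrences.  The index \<open>0\<close> carries the formal value \<open>1 / 0\<close>
and the index \<open>1\<close> the convergent \<open>0 / 1\<close>, so that the index agrees with the numbering of the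
convergents from \<open>1\<close>.\<close>

fun cf_num :: "(nat \<Rightarrow> int) \<Rightarrow> nat \<Rightarrow> int" where
  "cf_num a 0 = 1"
| "cf_num a (Suc 0) = 0"
| "cf_num a (Suc (Suc n)) = a (Suc n) * cf_num a (Suc n) + cf_num a n"

fun cf_den :: "(nat \<Rightarrow> int) \<Rightarrow> nat \<Rightarrow> int" where
  "cf_den a 0 = 0"
| "cf_den a (Suc 0) = 1"
| "cf_den a (Suc (Suc n)) = a (Suc n) * cf_den a (Suc n) + cf_den a n"

lemma cf_determinant: "cf_num a (Suc n) * cf_den a n - cf_num a n * cf_den a (Suc n) = (- 1) ^ Suc n"
proof (induction n)
  case (Suc n)
  have "cf_num a (Suc (Suc n)) * cf_den a (Suc n) - cf_num a (Suc n) * cf_den a (Suc (Suc n))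
      = - (cf_num a (Suc n) * cf_den a n - cf_num a n * cf_den a (Suc n))"
    by (simp add: algebra_simps)
  then show ?case using Suc by simp
qed simp

lemma cf_coprime: "coprime (cf_num a n) (cf_den a n)"
proof (cases n)
  case (Suc m)
  show ?thesis unfolding Suc
  proof (rule coprimeI)
    fix c assume "c dvd cf_num a (Suc m)" "c dvd cf_den a (Suc m)"
    then have "c dvd cf_num a (Suc m) * cf_den a m - cf_num a m * cf_den a (Suc m)"
      by (intro dvd_diff) auto
    then show "is_unit c" unfolding cf_determinant by (simp add: minus_one_power_iff split: if_splits)
  qed
qed simp

context
  fixes a :: "nat \<Rightarrow> int"
  assumes a: "\<forall>i\<ge>1. a i \<ge> 1"
begin

lemma cf_den_pos: "0 \<le> cf_den a n \<and> 1 \<le> cf_den a (Suc n)"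
proof (induction n)
  case (Suc n)
  then have "1 * cf_den a (Suc n) \<le> a (Suc n) * cf_den a (Suc n)"
    using a[THEN spec, of "Suc n"] by (intro mult_right_mono) auto
  then have "1 \<le> cf_den a (Suc (Suc n))" using Suc unfolding cf_den.simps by linarith
  then show ?case using Suc by auto
qed simp

lemma cf_den_step: "cf_den a (Suc n) + cf_den a n \<le> cf_den a (Suc (Suc n))"
  using mult_right_mono[of 1 "a (Suc n)" "cf_den a (Suc n)"] a[THEN spec, of "Suc n"] cf_den_pos[of n]
  unfolding cf_den.simps by linarith

lemma cf_den_mono: "cf_den a n \<le> cf_den a (Suc n)"
proof (cases n)
  case (Suc m)
  show ?thesis unfolding Suc using cf_den_step[of m] cf_den_pos[of m] by linarith
qed simp

text \<open>A continued fraction with an arbitrary tail \<open>y\<close>: the tail \<open>0\<close> yields the convergents, over the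
rationals, and the tail \<open>cf_rem x n\<close> yields \<open>x\<close> itself, over the reals.\<close>

lemma cf_tail_eq:
  fixes y :: "'a :: linordered_field"
  assumes "y \<ge> 0"
  shows "foldr (\<lambda>b z. 1 / (of_int b + z)) (map a [1..<Suc n]) y
    = (of_int (cf_num a (Suc n)) + y * of_int (cf_num a n)) / (of_int (cf_den a (Suc n)) + y * of_int (cf_den a n))"
  using assms
proof (induction n arbitrary: y)
  case (Suc n)
  define z where "z = 1 / (of_int (a (Suc n)) + y)"
  have "1 \<le> (of_int (a (Suc n)) :: 'a)" using a[THEN spec, of "Suc n"] by simp
  then have d: "0 < of_int (a (Suc n)) + y" using Suc.prems by linarith
  then have "0 \<le> z" by (simp add: z_def)
  have "foldr (\<lambda>b z. 1 / (of_int b + z)) (map a [1..<Suc (Suc n)]) y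
      = foldr (\<lambda>b z. 1 / (of_int b + z)) (map a [1..<Suc n]) z"
    by (simp add: z_def)
  also have "\<dots> = (of_int (cf_num a (Suc n)) + z * of_int (cf_num a n)) / (of_int (cf_den a (Suc n)) + z * of_int (cf_den a n))"
    using \<open>0 \<le> z\<close> by (rule Suc.IH)
  also have "\<dots> = ((of_int (a (Suc n)) + y) * (of_int (cf_num a (Suc n)) + z * of_int (cf_num a n)))
      / ((of_int (a (Suc n)) + y) * (of_int (cf_den a (Suc n)) + z * of_int (cf_den a n)))"
    using d by simp
  also have "\<dots> = (of_int (cf_num a (Suc (Suc n))) + y * of_int (cf_num a (Suc n)))
      / (of_int (cf_den a (Suc (Suc n))) + y * of_int (cf_den a (Suc n)))"
  proof -
    have expand: "(of_int (a (Suc n)) + y) * (u + z * v) = (of_int (a (Suc n)) + y) * u + v" for u v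
      using d by (simp add: z_def field_simps)
    show ?thesis unfolding expand by (simp add: algebra_simps)
  qed
  finally show ?case .
qed simp

end

lemma cf_eval_foldr: "cf_eval as = foldr (\<lambda>b z. 1 / (of_int b + z)) as 0"
  by (induction as) simp_all

lemma irrational_cf_rem:
  assumes "x \<in> {0..<1} - \<rat>"
  shows "cf_rem x n \<in> {0<..<1} - \<rat>"
proof (induction n)
  case 0
  then show ?case using assms by (auto simp: less_le)
next
  case (Suc n)
  then have "1 / cf_rem x n \<notin> \<rat>" using Rats_divide[of 1 "1 / cf_rem x n"] by auto
  moreover have "1 / cf_rem x n = cf_rem x (Suc n) + of_int \<lfloor>1 / cf_rem x n\<rfloor>"
    by (simp add: frac_def)
  ultimately have "cf_rem x (Suc n) \<notin> \<rat>" by (metis Rats_add Rats_of_int)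
  moreover have "0 \<le> cf_rem x (Suc n)" "cf_rem x (Suc n) < 1" by (simp_all add: frac_lt_1)
  moreover have "cf_rem x (Suc n) \<noteq> 0" using \<open>cf_rem x (Suc n) \<notin> \<rat>\<close> by (metis Rats_0)
  ultimately show ?case by (simp add: less_le)
qed

lemma inverse_cf_rem: "1 / cf_rem x n = of_int (cf_quot x (Suc n)) + cf_rem x (Suc n)"
  by (simp add: cf_quot_def frac_def)

lemma cf_quot_pos:
  assumes "x \<in> {0..<1} - \<rat>"
  shows "\<forall>i\<ge>1. cf_quot x i \<ge> 1"
proof (intro allI impI)
  fix i :: nat assume "i \<ge> 1"
  then show "cf_quot x i \<ge> 1"
    using irrational_cf_rem[OF assms, of "i - 1"] by (simp add: cf_quot_def)
qed

lemma irrational_eq_cf_tail: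
  assumes x: "x \<in> {0..<1} - \<rat>"
  shows "x = foldr (\<lambda>b z. 1 / (of_int b + z)) (map (cf_quot x) [1..<Suc n]) (cf_rem x n)"
proof (induction n)
  case (Suc n)
  have "cf_rem x n = 1 / (of_int (cf_quot x (Suc n)) + cf_rem x (Suc n))"
    unfolding inverse_cf_rem[symmetric] by simp
  moreover have "foldr (\<lambda>b z. 1 / (of_int b + z)) (map (cf_quot x) [1..<Suc (Suc n)]) (cf_rem x (Suc n))
      = foldr (\<lambda>b z. 1 / (of_int b + z)) (map (cf_quot x) [1..<Suc n])
          (1 / (of_int (cf_quot x (Suc n)) + cf_rem x (Suc n)))"
    by (simp del: cf_rem.simps)
  ultimately show ?case using Suc by metis
qed simp

lemma quotient_of_coprime_quotient:
  assumes "coprime p q" "0 < q"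
  shows "quotient_of (of_int p / of_int q) = (p, q)"
  using assms by (simp add: Fract_of_int_quotient[symmetric] quotient_of_Fract normalize_stable)

lemma quotient_of_convergent:
  assumes x: "x \<in> {0..<1} - \<rat>"
  shows "quotient_of (convergent_cf x (Suc n)) = (cf_num (cf_quot x) (Suc n), cf_den (cf_quot x) (Suc n))"
proof -
  have "convergent_cf x (Suc n) = of_int (cf_num (cf_quot x) (Suc n)) / of_int (cf_den (cf_quot x) (Suc n))"
    unfolding convergent_cf_def cf_eval_foldr using cf_tail_eq[OF cf_quot_pos[OF x], of 0 n] by simp
  then show ?thesis
    using quotient_of_coprime_quotient[OF cf_coprime] cf_den_pos[OF cf_quot_pos[OF x], of n] by simp
qed

lemma convergent_den_eq:
  assumes x: "x \<in> {0..<1} - \<rat>"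
  shows "convergent_den x (Suc n) = cf_den (cf_quot x) (Suc n)"
  by (simp add: convergent_den_def quotient_of_convergent[OF x])

text \<open>Subtracting \<open>p / q\<close> from the expression of \<open>x\<close> by its tail \<open>y\<close> leaves the determinant \<open>\<plusminus> 1\<close> in the
numerator, and \<open>|x - p / q| = 1 / (q (Q + q y'))\<close> with the next tail \<open>y' \<in> (0, 1)\<close>.\<close>

lemma convergent_approximation:
  fixes x :: real and n :: nat
  assumes x: "x \<in> {0..<1} - \<rat>"
  defines "p \<equiv> real_of_int (cf_num (cf_quot x) (Suc n))"
    and "q \<equiv> real_of_int (cf_den (cf_quot x) (Suc n))"
    and "Q \<equiv> real_of_int (cf_den (cf_quot x) (Suc (Suc n)))"
  shows "1 / (2 * q * Q) \<le> \<bar>x - p / q\<bar>" "\<bar>x - p / q\<bar> \<le> 1 / (q * Q)"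
proof -
  define y where "y = cf_rem x n"
  define y' where "y' = cf_rem x (Suc n)"
  define u where "u = real_of_int (cf_num (cf_quot x) n)"
  define v where "v = real_of_int (cf_den (cf_quot x) n)"
  have y: "0 < y" "y < 1" and y': "0 < y'" "y' < 1"
    using irrational_cf_rem[OF x, of n] irrational_cf_rem[OF x, of "Suc n"] by (auto simp: y_def y'_def)
  have q: "1 \<le> q" and v: "0 \<le> v"
    using cf_den_pos[OF cf_quot_pos[OF x], of n] by (auto simp: q_def v_def)
  have qQ: "q \<le> Q" unfolding q_def Q_def using cf_den_mono[OF cf_quot_pos[OF x], of "Suc n"]
    by (simp only: of_int_le_iff)
  have Q: "Q = real_of_int (cf_quot x (Suc n)) * q + v" by (simp add: Q_def q_def v_def)
  have det: "\<bar>u * q - p * v\<bar> = 1"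
  proof -
    have "u * q - p * v = - real_of_int (cf_num (cf_quot x) (Suc n) * cf_den (cf_quot x) n
        - cf_num (cf_quot x) n * cf_den (cf_quot x) (Suc n))"
      by (simp add: p_def q_def u_def v_def)
    also have "\<dots> = - ((- 1) ^ Suc n)" unfolding cf_determinant by simp
    finally show ?thesis by (simp add: power_abs)
  qed
  have "x = (p + y * u) / (q + y * v)"
    using irrational_eq_cf_tail[OF x, of n] cf_tail_eq[OF cf_quot_pos[OF x], of y n] y
    by (simp add: p_def q_def u_def v_def y_def)
  moreover have pos: "0 < q + y * v" using q v y by (simp add: add_pos_nonneg)
  ultimately have "x - p / q = ((p + y * u) * q - p * (q + y * v)) / ((q + y * v) * q)"
    using q by (simp add: diff_frac_eq)
  also have "\<dots> = y * (u * q - p * v) / (q * (q + y * v))" by (simp add: algebra_simps)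
  finally have "x - p / q = y * (u * q - p * v) / (q * (q + y * v))" .
  then have "\<bar>x - p / q\<bar> = y / (q * (q + y * v))"
    using det pos q y by (simp add: abs_mult)
  also have "\<dots> = 1 / (q * (q * (1 / y) + v))" using y q by (simp add: field_simps)
  also have "1 / y = real_of_int (cf_quot x (Suc n)) + y'" unfolding y_def y'_def by (rule inverse_cf_rem)
  also have "q * (real_of_int (cf_quot x (Suc n)) + y') + v = Q + q * y'" by (simp add: Q algebra_simps)
  finally have eq: "\<bar>x - p / q\<bar> = 1 / (q * (Q + q * y'))" .
  have "0 \<le> q * y'" "q * y' \<le> Q" using q y' qQ mult_mono[of q Q y' 1] by auto
  then show "1 / (2 * q * Q) \<le> \<bar>x - p / q\<bar>" "\<bar>x - p / q\<bar> \<le> 1 / (q * Q)"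
    unfolding eq using q qQ by (auto intro!: divide_left_mono mult_pos_pos simp: mult.assoc)
qed

text \<open>Denominators at least double every two steps; both parities are carried along in the induction.\<close>

lemma cf_den_growth:
  assumes a: "\<forall>i\<ge>1. a i \<ge> 1"
  shows "2 powr ((real n - 1) / 2) \<le> real_of_int (cf_den a (Suc n)) \<and>
    2 powr (real n / 2) \<le> real_of_int (cf_den a (Suc (Suc n)))"
proof (induction n)
  case 0
  have "2 powr (- 1 / 2) \<le> (2::real) powr 0" by (intro powr_mono) auto
  then show ?case using a[THEN spec, of 1] by simp
next
  case (Suc n)
  have "2 powr (real (Suc n) / 2) = 2 * (2 powr ((real n - 1) / 2) :: real)"
  proof -
    have "real (Suc n) / 2 = 1 + (real n - 1) / 2" by (simp add: field_simps)
    then show ?thesis by (simp only: powr_add) simp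
  qed
  also have "\<dots> \<le> 2 * real_of_int (cf_den a (Suc n))" using Suc by simp
  also have "\<dots> \<le> real_of_int (cf_den a (Suc (Suc (Suc n))))"
  proof -
    have "2 * cf_den a (Suc n) \<le> cf_den a (Suc (Suc (Suc n)))"
      using cf_den_step[OF a, of "Suc n"] cf_den_mono[OF a, of "Suc n"] by linarith
    then have "real_of_int (2 * cf_den a (Suc n)) \<le> real_of_int (cf_den a (Suc (Suc (Suc n))))"
      by (simp only: of_int_le_iff)
    then show ?thesis by simp
  qed
  finally show ?case using Suc by simp
qed

section \<open>Comparing a series with a series of block sums\<close>

text \<open>If the block sums of \<open>f\<close> agree with \<open>t\<close> up to summable errors, the partial sums of the two series at the
ends of blocks differ by a convergent sequence.  In the interior of the blocks, the partial
sums of \<open>f\<close> stray from the block ends by at most \<open>|t j| + E j\<close>, which tends to \<open>0\<close> as soon as \<open>t\<close> is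
summable.  The term \<open>f 1\<close> precedes the first block.\<close>

lemma block_sum_comparison:
  fixes f t :: "nat \<Rightarrow> complex" and b :: "nat \<Rightarrow> nat" and E :: "nat \<Rightarrow> real"
  assumes b0: "b 0 = 1" and mono: "\<And>j. b j \<le> b (Suc j)" and lim: "filterlim b at_top sequentially"
    and E: "summable E"
    and full: "\<And>j. cmod ((\<Sum>n\<in>{b j<..b (Suc j)}. f n) - t j) \<le> E j"
    and part: "\<And>j N. b j \<le> N \<Longrightarrow> N \<le> b (Suc j) \<Longrightarrow> cmod (\<Sum>n\<in>{b j<..N}. f n) \<le> cmod (t j) + E j"
  shows "summable (\<lambda>n. f (Suc n)) \<longleftrightarrow> summable t"
    and "summable t \<Longrightarrow> cmod ((\<Sum>i. t i) - (\<Sum>n. f (Suc n))) \<le> cmod (f 1) + (\<Sum>j. E j)"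
proof -
  define S where "S = (\<lambda>N. \<Sum>n<N. f (Suc n))"
  define d where "d j = (\<Sum>n\<in>{b j<..b (Suc j)}. f n) - t j" for j
  have d: "summable d" by (rule summable_comparison_test'[OF E, of 0]) (simp add: d_def full)
  have S_diff: "S N = S M + (\<Sum>n\<in>{M<..N}. f n)" if "M \<le> N" for M N
    using that
  proof (induction N rule: dec_induct)
    case (step N)
    have "{M<..Suc N} = insert (Suc N) {M<..N}" using step by auto
    then show ?case using step by (simp add: S_def)
  qed simp
  have Sb: "S (b J) = f 1 + (\<Sum>j<J. t j) + (\<Sum>j<J. d j)" for J
  proof (induction J)
    case 0 show ?case by (simp add: S_def b0)
  next
    case (Suc J)
    then show ?case using S_diff[OF mono[of J]] by (simp add: d_def)
  qed
  have d_lim: "(\<lambda>J. \<Sum>j<J. d j) \<longlonglongrightarrow> suminf d" using d by (rule summable_LIMSEQ)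
  have mono_le: "b i \<le> b j" if "i \<le> j" for i j using lift_Suc_mono_le[of b] mono that by blast
  have fwd: "t sums (s - f 1 - suminf d)" if "(\<lambda>n. f (Suc n)) sums s" for s
  proof -
    have "S \<longlonglongrightarrow> s" using that by (simp add: sums_def S_def)
    then have "(\<lambda>J. S (b J)) \<longlonglongrightarrow> s" using lim by (rule filterlim_compose)
    then have "(\<lambda>J. S (b J) - f 1 - (\<Sum>j<J. d j)) \<longlonglongrightarrow> s - f 1 - suminf d"
      by (intro tendsto_intros d_lim)
    then show ?thesis by (simp add: Sb sums_def)
  qed
  have bwd: "summable (\<lambda>n. f (Suc n))" if t: "summable t"
  proof -
    define s where "s = f 1 + suminf t + suminf d"
    have Sb_lim: "(\<lambda>J. S (b J)) \<longlonglongrightarrow> s"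
      unfolding Sb s_def by (intro tendsto_intros d_lim summable_LIMSEQ t)
    have te: "(\<lambda>J. cmod (t J) + E J) \<longlonglongrightarrow> 0"
      using tendsto_add[OF tendsto_norm_zero[OF summable_LIMSEQ_zero[OF t]] summable_LIMSEQ_zero[OF E]] by simp
    have "S \<longlonglongrightarrow> s"
    proof (rule LIMSEQ_I)
      fix e :: real assume "0 < e"
      then have "\<forall>\<^sub>F J in sequentially. dist (S (b J)) s < e / 2 \<and> dist (cmod (t J) + E J) 0 < e / 2"
        by (intro eventually_conj tendstoD[OF Sb_lim] tendstoD[OF te]) auto
      then obtain J0 where J0: "\<And>J. J \<ge> J0 \<Longrightarrow> dist (S (b J)) s < e / 2 \<and> dist (cmod (t J) + E J) 0 < e / 2"
        by (auto simp: eventually_sequentially)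
      show "\<exists>N0. \<forall>N\<ge>N0. cmod (S N - s) < e"
      proof (intro exI[of _ "b J0"] allI impI)
        fix N assume N: "b J0 \<le> N"
        have "\<forall>\<^sub>F j in sequentially. Suc N \<le> b j" using lim by (simp add: filterlim_at_top)
        then obtain j0 where "\<And>j. j \<ge> j0 \<Longrightarrow> Suc N \<le> b j" by (auto simp: eventually_sequentially)
        then have ex: "N < b (Suc j0)" by (simp add: Suc_le_lessD)
        define J where "J = (LEAST j. N < b (Suc j))"
        have J1: "N < b (Suc J)" unfolding J_def by (rule LeastI) (rule ex)
        have "J0 \<le> J" using J1 N mono_le[of "Suc J" J0] by linarith
        have "b J \<le> N"
        proof (cases J)
          case 0 then show ?thesis using N mono_le[of 0 J0] by simp
        next
          case (Suc i)
          then have "\<not> N < b (Suc i)" using not_less_Least[of i "\<lambda>j. N < b (Suc j)"] by (simp add: J_def)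
          then show ?thesis using Suc by simp
        qed
        then have "cmod (S N - S (b J)) \<le> cmod (t J) + E J"
          using S_diff[of "b J" N] part[of J N] J1 by simp
        moreover have "cmod (S (b J) - s) < e / 2" "\<bar>cmod (t J) + E J\<bar> < e / 2"
          using J0[OF \<open>J0 \<le> J\<close>] by (simp_all add: dist_norm)
        moreover have "cmod (S N - s) \<le> cmod (S N - S (b J)) + cmod (S (b J) - s)"
          using norm_triangle_ineq[of "S N - S (b J)" "S (b J) - s"] by simp
        ultimately show "cmod (S N - s) < e" by linarith
      qed
    qed
    then show ?thesis unfolding S_def summable_def sums_def by blast
  qed
  show iff: "summable (\<lambda>n. f (Suc n)) \<longleftrightarrow> summable t"
    using fwd bwd by (meson summable_def)
  show "cmod ((\<Sum>i. t i) - (\<Sum>n. f (Suc n))) \<le> cmod (f 1) + (\<Sum>j. E j)" if "summable t"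
  proof -
    have "t sums ((\<Sum>n. f (Suc n)) - f 1 - suminf d)" using fwd bwd[OF that] by (simp add: summable_sums)
    then have "(\<Sum>i. t i) - (\<Sum>n. f (Suc n)) = - (f 1 + suminf d)" by (simp add: sums_unique[symmetric])
    then have "cmod ((\<Sum>i. t i) - (\<Sum>n. f (Suc n))) \<le> cmod (f 1) + cmod (suminf d)"
      by (simp only: norm_minus_cancel norm_triangle_ineq)
    also have "cmod (suminf d) \<le> (\<Sum>j. E j)"
      using norm_suminf_le[OF _ E, of d] full by (simp add: d_def)
    finally show ?thesis by simp
  qed
qed

section \<open>The two series\<close>

context monomial_weyl
begin

abbreviation den :: "real \<Rightarrow> nat \<Rightarrow> nat" where
  "den x j \<equiv> nat (convergent_den x (Suc j))"

lemma den_eq: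
  assumes x: "x \<in> {0..<1} - \<rat>"
  shows "int (den x j) = cf_den (cf_quot x) (Suc j)"
  using cf_den_pos[OF cf_quot_pos[OF x], of j] by (simp add: convergent_den_eq[OF x])

lemma real_den:
  assumes x: "x \<in> {0..<1} - \<rat>"
  shows "real (den x j) = of_int (cf_den (cf_quot x) (Suc j))"
  unfolding den_eq[OF x, symmetric] by simp

lemma den_mono:
  assumes x: "x \<in> {0..<1} - \<rat>"
  shows "den x j \<le> den x (Suc j)"
  using cf_den_mono[OF cf_quot_pos[OF x], of "Suc j"] by (simp add: convergent_den_eq[OF x])

lemma rational_scale_convergent:
  assumes x: "x \<in> {0..<1} - \<rat>"
  shows "rational_scale k A B x (convergent_cf x (Suc j)) (cf_num (cf_quot x) (Suc j)) (den x j) (den x (Suc j))"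
proof
  show "quotient_of (convergent_cf x (Suc j)) = (cf_num (cf_quot x) (Suc j), int (den x j))"
    unfolding den_eq[OF x] by (rule quotient_of_convergent[OF x])
  show "den x j \<le> den x (Suc j)" by (rule den_mono[OF x])
  show "1 / (2 * real (den x j) * real (den x (Suc j)))
      \<le> \<bar>x - real_of_int (cf_num (cf_quot x) (Suc j)) / real (den x j)\<bar>"
    unfolding real_den[OF x] by (rule convergent_approximation[OF x])
  show "\<bar>x - real_of_int (cf_num (cf_quot x) (Suc j)) / real (den x j)\<bar>
      \<le> 1 / (real (den x j) * real (den x (Suc j)))"
    unfolding real_den[OF x] by (rule convergent_approximation[OF x])
qed

text \<open>Bounds the error in the \<open>j\<close>-th block for all \<open>x\<close> simultaneously, by the growth of denominators.\<close>

definition block_error :: "nat \<Rightarrow> real" where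
  "block_error j = scale_const * (2 powr (\<eta> / 2) * (2 powr (- \<eta> / 2)) ^ j)"

lemma summable_block_error: "summable block_error"
proof -
  have "2 powr (- \<eta> / 2) < 1" using \<eta>(1) by (intro powr_less_one) auto
  then have "summable (\<lambda>j. (2 powr (- \<eta> / 2)) ^ j)" by (intro summable_geometric) simp
  then show ?thesis unfolding block_error_def by (intro summable_mult)
qed

lemma den_growth:
  assumes x: "x \<in> {0..<1} - \<rat>"
  shows "2 powr ((real j - 1) / 2) \<le> real (den x j)"
  using cf_den_growth[OF cf_quot_pos[OF x], of j] by (simp add: real_den[OF x])

lemma scale_error_le_block_error:
  assumes x: "x \<in> {0..<1} - \<rat>"
  shows "scale_const * real (den x j) powr (- \<eta>) \<le> block_error j"
proof -
  have "real (den x j) powr (- \<eta>) \<le> (2 powr ((real j - 1) / 2)) powr (- \<eta>)"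
    using den_growth[OF x] \<eta>(1) by (intro powr_mono2') auto
  also have "\<dots> = 2 powr (\<eta> / 2 + (- \<eta> / 2) * real j)"
    unfolding powr_powr by (simp add: field_simps)
  also have "(2::real) powr (\<eta> / 2 + (- \<eta> / 2) * real j) = 2 powr (\<eta> / 2) * (2 powr (- \<eta> / 2)) ^ j"
    unfolding powr_add by (subst powr_power) (simp_all add: mult.commute)
  finally show ?thesis unfolding block_error_def using scale_const_nonneg by (rule mult_left_mono)
qed

lemma blocks_at_top:
  assumes x: "x \<in> {0..<1} - \<rat>"
  shows "filterlim (\<lambda>j. den x j ^ 2) at_top sequentially"
  unfolding filterlim_at_top
proof
  fix Z
  have "Z \<le> den x j ^ 2" if "2 * Z \<le> j" for j
  proof -
    have "real j \<le> 2 ^ j" using of_nat_less_two_power[of j, where ?'a = real] by simp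
    also have "\<dots> = 2 * (2 powr ((real j - 1) / 2)) ^ 2"
    proof -
      have "(2 powr ((real j - 1) / 2)) ^ 2 = (2::real) powr (real 2 * ((real j - 1) / 2))"
        by (rule powr_power) simp
      also have "real 2 * ((real j - 1) / 2) = real j - 1" by simp
      finally show ?thesis by (simp add: powr_diff powr_realpow)
    qed
    also have "\<dots> \<le> 2 * real (den x j) ^ 2"
      using den_growth[OF x] by (intro mult_left_mono power_mono) auto
    finally have "real j \<le> real (2 * den x j ^ 2)" by simp
    then have "j \<le> 2 * den x j ^ 2" by (simp only: of_nat_le_iff)
    then show ?thesis using that by linarith
  qed
  then show "\<forall>\<^sub>F j in sequentially. Z \<le> den x j ^ 2" unfolding eventually_sequentially by blast
qed

text \<open>The blocks are the ranges between the squares of consecutive denominators; the summand \<open>1\<close> is the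
modulus of the term \<open>n = 1\<close>, which precedes them.\<close>

lemma series_comparison:
  assumes x: "x \<in> {0..<1} - \<rat>"
  shows "summable (\<lambda>n. F_term k x (Suc n)) \<longleftrightarrow> summable (\<lambda>i. convergent_term k x (Suc i))"
    and "summable (\<lambda>i. convergent_term k x (Suc i)) \<Longrightarrow>
      cmod ((\<Sum>i. convergent_term k x (Suc i)) - (\<Sum>n. F_term k x (Suc n))) \<le> 1 + (\<Sum>j. block_error j)"
proof -
  have b0: "den x 0 ^ 2 = 1" by (simp add: convergent_den_eq[OF x])
  have mono: "den x j ^ 2 \<le> den x (Suc j) ^ 2" for j using den_mono[OF x] by (intro power_mono) auto
  have resonance: "rational_scale.resonance k (convergent_cf x (Suc j)) (den x j) (den x (Suc j))
      = convergent_term k x (Suc j)" for j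
  proof -
    interpret rational_scale k A B x "convergent_cf x (Suc j)" "cf_num (cf_quot x) (Suc j)" "den x j" "den x (Suc j)"
      by (rule rational_scale_convergent[OF x])
    have "real_of_int (convergent_den x (Suc i)) = real (den x i)" for i
      by (subst real_den[OF x]) (simp only: convergent_den_eq[OF x])
    moreover from this have "complex_of_real (of_int (convergent_den x (Suc i))) = complex_of_real (real (den x i))" for i
      by (rule arg_cong)
    then have "of_int (convergent_den x (Suc i)) = (of_nat (den x i) :: complex)" for i
      by (simp only: of_real_of_int_eq of_real_of_nat_eq)
    ultimately show ?thesis
      by (simp only: resonance_def mean_def convergent_term_def) simp
  qed
  have full: "cmod ((\<Sum>n\<in>{den x j ^ 2<..den x (Suc j) ^ 2}. F_term k x n) - convergent_term k x (Suc j))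
      \<le> block_error j" for j
    using rational_scale.full_scale_approx[OF rational_scale_convergent[OF x, of j]]
      scale_error_le_block_error[OF x, of j] unfolding resonance by linarith
  have part: "cmod (\<Sum>n\<in>{den x j ^ 2<..N}. F_term k x n) \<le> cmod (convergent_term k x (Suc j)) + block_error j"
    if "den x j ^ 2 \<le> N" "N \<le> den x (Suc j) ^ 2" for j N
    using rational_scale.partial_scale_bound[OF rational_scale_convergent[OF x, of j] that]
      scale_error_le_block_error[OF x, of j] unfolding resonance by linarith
  note compare = block_sum_comparison[of "\<lambda>j. den x j ^ 2" block_error "F_term k x" "\<lambda>i. convergent_term k x (Suc i)",
      OF b0 mono blocks_at_top[OF x] summable_block_error full part]
  show "summable (\<lambda>n. F_term k x (Suc n)) \<longleftrightarrow> summable (\<lambda>i. convergent_term k x (Suc i))"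
    by (rule compare(1))
  have "cmod (F_term k x 1) = 1" by (simp add: F_term_def)
  then show "summable (\<lambda>i. convergent_term k x (Suc i)) \<Longrightarrow>
      cmod ((\<Sum>i. convergent_term k x (Suc i)) - (\<Sum>n. F_term k x (Suc n))) \<le> 1 + (\<Sum>j. block_error j)"
    using compare(2) by simp
qed

end

theorem theorem1:
  fixes k :: nat
  assumes "k > 1"
  shows "(\<forall>x\<in>{0..<1} - \<rat>.
            summable (\<lambda>n. F_term k x (Suc n)) \<longleftrightarrow>
            summable (\<lambda>i. convergent_term k x (Suc i)))
       \<and> (\<exists>C::real. \<forall>x\<in>{0..<1} - \<rat>.
            summable (\<lambda>n. F_term k x (Suc n)) \<longrightarrow>
            summable (\<lambda>i. convergent_term k x (Suc i)) \<longrightarrow>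
            cmod ((\<Sum>i. convergent_term k x (Suc i)) - (\<Sum>n. F_term k x (Suc n))) \<le> C)"
proof -
  have "k \<ge> 1" using assms by simp
  then obtain A B where AB: "A \<ge> 1" "B \<ge> 1"
    "\<And>x N X M M'. 1 \<le> N \<Longrightarrow> 1 \<le> X \<Longrightarrow> M' - M \<le> N \<Longrightarrow>
      real N / X \<le> cmod (\<Sum>n\<in>{M..<M'}. unit_exp (of_nat n ^ k * x)) \<Longrightarrow>
      \<exists>q::nat. 1 \<le> q \<and> real q \<le> A * X ^ B \<and> near_int (A * X ^ B / real N ^ k) (of_nat q * x)"
    by (rule monomial_weyl_inverse) blast
  interpret monomial_weyl k A B
  proof
    show "2 \<le> k" using assms by simp
  qed (fact AB)+
  show ?thesis
    using series_comparison by (intro conjI ballI exI[of _ "1 + (\<Sum>j. block_error j)"] impI) simp_all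
qed

end
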